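(* Let $R$ be a commutative ring with $1$ of characteristic zero (i.e. $R\to R\otimes\mathbb{Q}$ is injective), let $p$ be a prime, and let $f=\sum_u a_u x^u\in R[x_1^{\pm1},\dots,x_n^{\pm1}]$ be a Laurent polynomial. Let $\Delta(f)\subset\mathbb{R}^n$ be its Newton polytope, let $J=\Delta(f)^\circ\cap\mathbb{Z}^n$ be the set of integral points in the topological interior of $\Delta(f)$, assume $J\neq\emptyset$ and put $g=\#J$. For $s\ge 0$ let $\alpha_s$ be the $g\times g$ matrix with entries in $R$, rows and columns indexed by $J$, given by $$(\alpha_s)_{u,v}=\text{the coefficient of } x^{p^s v-u} \text{ in } f(x)^{p^s-1},\qquad u,v\in J$$ (so $\alpha_0$ is the identity matrix). Then: (i) For every Frobenius endomorphism $\sigma:R\to R$ and every $s\ge1$, $$\alpha_s\equiv \alpha_1\cdot\sigma(\alpha_1)\cdots\sigma^{s-1}(\alpha_1)\mod p.$$ (ii) Assume that $\bar\alpha_1=\alpha_1\bmod p$ is invertible over $\bar R=R/pR$, and let $\sigma:R\to R$ be a Frobenius endomorphism. Then for all $s\ge1$, $$\alpha_{s+1}\cdot\sigma(\alpha_s)^{-1}\equiv \alpha_s\cdot\sigma(\alpha_{s-1})^{-1}\mod p^s.$$ (iii) Under the assumptions of (ii), for every derivation $D:R\to R$ and all $s,m\ge0$, $$D(\sigma^m(\alpha_{s+1}))\cdot\sigma^m(\alpha_{s+1})^{-1}\equiv D(\sigma^m(\alpha_s))\cdot\sigma^m(\alpha_s)^{-1}\mod p^{s+m}.$$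
   Context: A Frobenius endomorphism of $R$ is a ring endomorphism $\sigma:R\to R$ with $\sigma(r)\equiv r^p \bmod pR$ for all $r\in R$. A derivation $D:R\to R$ is an additive map with $D(r_1r_2)=D(r_1)r_2+r_1D(r_2)$. Both $\sigma$ and $D$ are applied to matrices entry-wise. The Newton polytope $\Delta(f)$ is the convex hull of $\{u: a_u\neq0\}$. In (ii) and (iii), the inverses of the matrices $\sigma^m(\alpha_s)$ are taken over the $p$-adic completion $\widehat R_p=\varprojlim R/p^sR$ (their determinants are units there when $\bar\alpha_1$ is invertible), and a congruence modulo $p^k$ between matrices means their difference has all entries in $p^k\widehat R_p$. *)

theory Defs
  imports
    "HOL-Analysis.Analysis"
    "HOL-Library.Poly_Mapping"
    "HOL-Computational_Algebra.Group_Closure"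
    "HOL-Algebra.QuotRing"
    "HOL-Algebra.Algebraic_Closure_Type"
begin

subsection \<open>Characteristic zero\<close>

text \<open>The tensor product of \<open>R\<close> and the rationals over the integers: the free abelian group on
  \<open>R \<times> \<rat>\<close> modulo the subgroup generated by the biadditivity relations. The pure tensor
  \<open>a \<otimes> q\<close> is a coset of that subgroup.\<close>

definition tensor_rat_relations :: "(('r::comm_ring_1 \<times> rat) \<Rightarrow>\<^sub>0 int) set" where
  "tensor_rat_relations = group_closure
     ({frag_of (a + b, q) - frag_of (a, q) - frag_of (b, q) |a b q. True} \<union>
      {frag_of (a, q + q') - frag_of (a, q) - frag_of (a, q') |a q q'. True})"

definition tensor_rat :: "'r::comm_ring_1 \<Rightarrow> rat \<Rightarrow> (('r \<times> rat) \<Rightarrow>\<^sub>0 int) set" where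
  "tensor_rat a q = {x. x - frag_of (a, q) \<in> tensor_rat_relations}"

definition char_zero :: "'r::comm_ring_1 itself \<Rightarrow> bool" where
  "char_zero _ \<longleftrightarrow> inj (\<lambda>r::'r. tensor_rat r 1)"


subsection \<open>Matrices indexed by a finite set\<close>

text \<open>A matrix over the ring \<open>S\<close> with rows and columns indexed by \<open>J\<close> is a function of two
  arguments, of which only the values on \<open>J \<times> J\<close> matter.\<close>

type_synonym ('i, 'a) matr = "'i \<Rightarrow> 'i \<Rightarrow> 'a"

definition mat_map :: "('a \<Rightarrow> 'b) \<Rightarrow> ('i, 'a) matr \<Rightarrow> ('i, 'b) matr" where
  "mat_map h A = (\<lambda>u v. h (A u v))"

definition mat_mult :: "('a, 'm) ring_scheme \<Rightarrow> 'i set \<Rightarrow> ('i, 'a) matr \<Rightarrow> ('i, 'a) matr \<Rightarrow> ('i, 'a) matr"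
  where "mat_mult S J A B = (\<lambda>u v. \<Oplus>\<^bsub>S\<^esub>w\<in>J. A u w \<otimes>\<^bsub>S\<^esub> B w v)"

definition mat_one :: "('a, 'm) ring_scheme \<Rightarrow> ('i, 'a) matr" where
  "mat_one S = (\<lambda>u v. if u = v then \<one>\<^bsub>S\<^esub> else \<zero>\<^bsub>S\<^esub>)"

primrec mat_prod :: "('a, 'm) ring_scheme \<Rightarrow> 'i set \<Rightarrow> (nat \<Rightarrow> ('i, 'a) matr) \<Rightarrow> nat \<Rightarrow> ('i, 'a) matr" where
  "mat_prod S J M 0 = mat_one S"
| "mat_prod S J M (Suc k) = mat_mult S J (mat_prod S J M k) (M k)"

definition is_mat_inverse ::
  "('a, 'm) ring_scheme \<Rightarrow> 'i set \<Rightarrow> ('i, 'a) matr \<Rightarrow> ('i, 'a) matr \<Rightarrow> bool" where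
  "is_mat_inverse S J A B \<longleftrightarrow>
     (\<forall>u\<in>J. \<forall>v\<in>J. B u v \<in> carrier S \<and>
        mat_mult S J A B u v = mat_one S u v \<and> mat_mult S J B A u v = mat_one S u v)"

definition mat_invertible :: "('a, 'm) ring_scheme \<Rightarrow> 'i set \<Rightarrow> ('i, 'a) matr \<Rightarrow> bool" where
  "mat_invertible S J A \<longleftrightarrow> (\<exists>B. is_mat_inverse S J A B)"

text \<open>Meaningful for invertible matrices only, whose inverse is unique on \<open>J \<times> J\<close>.\<close>

definition mat_inverse :: "('a, 'm) ring_scheme \<Rightarrow> 'i set \<Rightarrow> ('i, 'a) matr \<Rightarrow> ('i, 'a) matr" where
  "mat_inverse S J A = (SOME B. is_mat_inverse S J A B)"

definition mat_cong ::
  "('a, 'm) ring_scheme \<Rightarrow> 'i set \<Rightarrow> nat \<Rightarrow> ('i, 'a) matr \<Rightarrow> ('i, 'a) matr \<Rightarrow> bool" where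
  "mat_cong S J m A B \<longleftrightarrow>
     (\<forall>u\<in>J. \<forall>v\<in>J. A u v \<ominus>\<^bsub>S\<^esub> B u v \<in> PIdl\<^bsub>S\<^esub> ([m] \<cdot>\<^bsub>S\<^esub> \<one>\<^bsub>S\<^esub>))"


subsection \<open>Residue rings and the \<open>p\<close>-adic completion\<close>

abbreviation base_ring :: "'r::comm_ring_1 ring" where
  "base_ring \<equiv> ring_of_type_algebra"

definition pow_ideal :: "nat \<Rightarrow> nat \<Rightarrow> 'r::comm_ring_1 set" where
  "pow_ideal p s = PIdl\<^bsub>base_ring\<^esub> (of_nat (p ^ s))"

definition residue_quot :: "nat \<Rightarrow> nat \<Rightarrow> 'r::comm_ring_1 set ring" where
  "residue_quot p s = base_ring Quot pow_ideal p s"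

definition to_residue :: "nat \<Rightarrow> nat \<Rightarrow> 'r::comm_ring_1 \<Rightarrow> 'r set" where
  "to_residue p s r = pow_ideal p s +>\<^bsub>base_ring\<^esub> r"

text \<open>The transition map from \<open>R / p\<^sup>s\<^sup>+\<^sup>1R\<close> to \<open>R / p\<^sup>sR\<close> sends a coset to the unique coset
  containing it, so the elements of the inverse limit are the decreasing sequences of cosets.\<close>

definition padic_completion :: "nat \<Rightarrow> (nat \<Rightarrow> 'r::comm_ring_1 set) ring" where
  "padic_completion p =
     \<lparr>carrier = {x. \<forall>s. x s \<in> carrier (residue_quot p s) \<and> x (Suc s) \<subseteq> x s},
      mult = (\<lambda>x y s. x s \<otimes>\<^bsub>residue_quot p s\<^esub> y s),
      one = (\<lambda>s. \<one>\<^bsub>residue_quot p s\<^esub>),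
      zero = (\<lambda>s. \<zero>\<^bsub>residue_quot p s\<^esub>),
      add = (\<lambda>x y s. x s \<oplus>\<^bsub>residue_quot p s\<^esub> y s)\<rparr>"

definition to_completion :: "nat \<Rightarrow> 'r::comm_ring_1 \<Rightarrow> nat \<Rightarrow> 'r set" where
  "to_completion p r = (\<lambda>s. to_residue p s r)"


subsection \<open>Frobenius endomorphisms and derivations\<close>

definition frobenius_endo :: "nat \<Rightarrow> ('r::comm_ring_1 \<Rightarrow> 'r) \<Rightarrow> bool" where
  "frobenius_endo p \<sigma> \<longleftrightarrow>
     \<sigma> \<in> ring_hom base_ring base_ring \<and> (\<forall>r. of_nat p dvd \<sigma> r - r ^ p)"

definition is_derivation :: "('r::comm_ring_1 \<Rightarrow> 'r) \<Rightarrow> bool" where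
  "is_derivation D \<longleftrightarrow>
     (\<forall>a b. D (a + b) = D a + D b) \<and> (\<forall>a b. D (a * b) = D a * b + a * D b)"


subsection \<open>Laurent polynomials and higher Hasse--Witt matrices\<close>

text \<open>Laurent polynomials in variables indexed by \<open>'n\<close> are finitely supported functions on
  \<open>\<int>\<^sup>n\<close>, with convolution as product.\<close>

type_synonym ('r, 'n) laurent = "(int ^ 'n) \<Rightarrow>\<^sub>0 'r"

definition real_point :: "int ^ 'n \<Rightarrow> real ^ 'n" where
  "real_point u = (\<chi> i. real_of_int (u $ i))"

definition newton_polytope :: "('r::zero, 'n::finite) laurent \<Rightarrow> (real ^ 'n) set" where
  "newton_polytope f = convex hull (real_point ` Poly_Mapping.keys f)"

definition interior_points :: "('r::zero, 'n::finite) laurent \<Rightarrow> (int ^ 'n) set" where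
  "interior_points f = {u. real_point u \<in> interior (newton_polytope f)}"

definition hasse_witt ::
  "nat \<Rightarrow> ('r::comm_ring_1, 'n::finite) laurent \<Rightarrow> nat \<Rightarrow> (int ^ 'n, 'r) matr" where
  "hasse_witt p f s = (\<lambda>u v. Poly_Mapping.lookup (f ^ (p ^ s - 1)) (int (p ^ s) *s v - u))"


subsection \<open>Basic properties of the definitions\<close>


lemma tensor_rat_relationsI:
  "frag_of (a + b, q) - frag_of (a, q) - frag_of (b, q) \<in> tensor_rat_relations"
  "frag_of (a, q + q') - frag_of (a, q) - frag_of (a, q') \<in> tensor_rat_relations"
  unfolding tensor_rat_relations_def by (rule group_closure.base, blast)+

lemma tensor_rat_relations_diff:
  "x \<in> tensor_rat_relations \<Longrightarrow> y \<in> tensor_rat_relations \<Longrightarrow> x - y \<in> tensor_rat_relations"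
  unfolding tensor_rat_relations_def by (rule group_closure.diff)

lemma tensor_rat_relations_add:
  "x \<in> tensor_rat_relations \<Longrightarrow> y \<in> tensor_rat_relations \<Longrightarrow> x + y \<in> tensor_rat_relations"
  unfolding tensor_rat_relations_def by (rule group_closure_add)

lemma tensor_rat_relations_zero: "frag_of (0, q) \<in> tensor_rat_relations"
                                 "frag_of (a, 0) \<in> tensor_rat_relations"
  using tensor_rat_relations_diff[OF _ tensor_rat_relationsI(1)[of 0 0 q], of 0]
    tensor_rat_relations_diff[OF _ tensor_rat_relationsI(2)[of a 0 0], of 0]
  by (simp_all add: tensor_rat_relations_def)

lemma tensor_rat_eq_iff:
  "tensor_rat a q = tensor_rat b q' \<longleftrightarrow> frag_of (a, q) - frag_of (b, q') \<in> tensor_rat_relations"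
proof
  assume "tensor_rat a q = tensor_rat b q'"
  moreover have "frag_of (a, q) \<in> tensor_rat a q"
    by (simp add: tensor_rat_def tensor_rat_relations_def)
  ultimately show "frag_of (a, q) - frag_of (b, q') \<in> tensor_rat_relations"
    by (simp add: tensor_rat_def)
next
  assume *: "frag_of (a, q) - frag_of (b, q') \<in> tensor_rat_relations"
  show "tensor_rat a q = tensor_rat b q'"
    using tensor_rat_relations_add[OF _ *] tensor_rat_relations_diff[OF _ *]
    by (force simp: tensor_rat_def algebra_simps)
qed

lemma tensor_rat_swap:
  "frag_of (a, of_nat n * q) - frag_of (of_nat n * a, q) \<in> tensor_rat_relations"
proof (induction n)
  case 0
  then show ?case by (simp add: tensor_rat_relations_diff tensor_rat_relations_zero)
next
  case (Suc n)
  show ?case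
    using tensor_rat_relations_diff[OF
        tensor_rat_relations_add[OF Suc tensor_rat_relationsI(2)[of a q "of_nat n * q"]]
        tensor_rat_relationsI(1)[of a "of_nat n * a" q]]
    by (simp add: algebra_simps)
qed

definition frag_eval :: "('k \<Rightarrow> 'r) \<Rightarrow> ('k \<Rightarrow>\<^sub>0 int) \<Rightarrow> 'r::comm_ring_1" where
  "frag_eval g x = (\<Sum>k\<in>Poly_Mapping.keys x. of_int (Poly_Mapping.lookup x k) * g k)"

lemma frag_eval_of: "frag_eval g (frag_of k) = g k"
  by (simp add: frag_eval_def)

lemma frag_eval_diff: "frag_eval g (x - y) = frag_eval g x - frag_eval g y"
proof -
  let ?K = "Poly_Mapping.keys x \<union> Poly_Mapping.keys y"
  have "frag_eval g z = (\<Sum>k\<in>?K. of_int (Poly_Mapping.lookup z k) * g k)"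
    if "Poly_Mapping.keys z \<subseteq> ?K" for z
    unfolding frag_eval_def
    by (rule sum.mono_neutral_left) (use that in \<open>auto simp: in_keys_iff\<close>)
  from this[of x] this[of y] this[of "x - y"] show ?thesis
    using keys_diff[of x y]
    by (simp add: sum_subtractf lookup_minus left_diff_distrib)
qed

lemma rat_clear_denominator: "\<exists>N::nat. N > 0 \<and> (\<forall>M. N dvd M \<longrightarrow> of_nat M * (q::rat) \<in> \<int>)"
proof -
  obtain a b where q: "q = Rat.Fract a b" "b > 0" by (cases q)
  have "of_nat M * q \<in> \<int>" if "nat b dvd M" for M
  proof -
    from that obtain c where "M = nat b * c" ..
    then have "of_nat M * q = of_int (int c * a)"
      using q by (simp add: Fract_of_int_quotient)
    then show ?thesis by (metis Ints_of_int)
  qed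
  then show ?thesis using q by (intro exI[of _ "nat b"]) auto
qed

lemma floor_add_Ints: "x \<in> \<int> \<Longrightarrow> \<lfloor>x + y\<rfloor> = \<lfloor>x\<rfloor> + \<lfloor>y :: rat\<rfloor>"
  by (auto elim!: Ints_cases)

lemma tensor_rat_relations_eval:
  assumes "x \<in> (tensor_rat_relations :: (('r::comm_ring_1 \<times> rat) \<Rightarrow>\<^sub>0 int) set)"
  shows "\<exists>N>0. \<forall>M. N dvd M \<longrightarrow> frag_eval (\<lambda>(a, q). of_int \<lfloor>of_nat M * q\<rfloor> * a) x = 0"
  using assms unfolding tensor_rat_relations_def
proof (induction rule: group_closure.induct)
  case (base s)
  consider "s = 0"
    | a b q where "s = frag_of (a + b, q) - frag_of (a, q) - frag_of (b, q)"
    | a q q' where "s = frag_of (a, q + q') - frag_of (a, q) - frag_of (a, q')"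
    using base by blast
  then show ?case
  proof cases
    case 1 then show ?thesis by (auto simp: frag_eval_def)
  next
    case 2 then show ?thesis unfolding 2 by (intro exI[of _ 1]) (simp add: frag_eval_diff frag_eval_of distrib_left)
  next
    case 3
    obtain N where "N > 0" "\<forall>M. N dvd M \<longrightarrow> of_nat M * q \<in> \<int>" using rat_clear_denominator by blast
    then show ?thesis
      by (intro exI[of _ N])
        (auto simp: 3 frag_eval_diff frag_eval_of distrib_left floor_add_Ints distrib_right)
  qed
next
  case (diff s t)
  then obtain N N' where N: "N > 0" "N' > 0"
    "\<forall>M. N dvd M \<longrightarrow> frag_eval (\<lambda>(a, q). of_int \<lfloor>of_nat M * q\<rfloor> * a) s = 0"
    "\<forall>M. N' dvd M \<longrightarrow> frag_eval (\<lambda>(a, q). of_int \<lfloor>of_nat M * q\<rfloor> * a) t = 0" by blast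
  have "frag_eval (\<lambda>(a, q). of_int \<lfloor>of_nat M * q\<rfloor> * a) (s - t) = 0" if "N * N' dvd M" for M
    using N(3)[rule_format, OF dvd_mult_left[OF that]] N(4)[rule_format, OF dvd_mult_right[OF that]]
    by (simp add: frag_eval_diff)
  with N(1,2) show ?case by (intro exI[of _ "N * N'"]) auto
qed

lemma char_zero_iff_torsion_free:
  "char_zero TYPE('r::comm_ring_1) \<longleftrightarrow> (\<forall>n>0. \<forall>r::'r. of_nat n * r = 0 \<longrightarrow> r = 0)"
proof (intro iffI allI impI)
  fix n :: nat and r :: 'r
  assume c: "char_zero TYPE('r)" and n: "n > 0" and r: "of_nat n * r = 0"
  have "frag_of (r, 1) - frag_of (0, 1 / of_nat n) \<in> tensor_rat_relations"
    using tensor_rat_swap[of r n "1 / of_nat n"] n r by simp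
  from tensor_rat_relations_add[OF this tensor_rat_relations_zero(1)[of "1 / of_nat n"]]
  have "frag_of (r, 1) \<in> tensor_rat_relations" by simp
  from tensor_rat_relations_diff[OF this tensor_rat_relations_zero(1)[of 1]]
  have "tensor_rat r 1 = tensor_rat 0 1"
    by (simp add: tensor_rat_eq_iff)
  then show "r = 0" using c unfolding char_zero_def by (rule injD[rotated])
next
  assume t: "\<forall>n>0. \<forall>r::'r. of_nat n * r = 0 \<longrightarrow> r = 0"
  show "char_zero TYPE('r)"
    unfolding char_zero_def
  proof (rule injI)
    fix a b :: 'r
    assume "tensor_rat a 1 = tensor_rat b 1"
    then have "frag_of (a, 1) - frag_of (b, 1) \<in> tensor_rat_relations"
      by (simp only: tensor_rat_eq_iff)
    from tensor_rat_relations_eval[OF this] obtain N where N: "N > 0" "\<forall>M. N dvd M \<longrightarrow>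
      frag_eval (\<lambda>(a, q). of_int \<lfloor>of_nat M * q\<rfloor> * a) (frag_of (a, 1::rat) - frag_of (b, 1)) = 0"
      by blast
    from N(2)[rule_format, of N] have "of_nat N * (a - b) = 0"
      by (simp add: frag_eval_diff frag_eval_of algebra_simps)
    with N(1) t have "a - b = 0" by blast
    then show "a = b" by simp
  qed
qed

lemma pow_ideal_ideal: "ideal (pow_ideal p s) (base_ring :: 'r::comm_ring_1 ring)"
  unfolding pow_ideal_def
  by (rule cring.cgenideal_ideal[OF cring_from_type_algebra]) (simp add: ring_of_type_algebra_def)

lemma cring_residue_quot: "cring (residue_quot p s :: 'r::comm_ring_1 set ring)"
  unfolding residue_quot_def
  by (rule ideal.quotient_is_cring[OF pow_ideal_ideal cring_from_type_algebra])

lemma mem_to_residue: "y \<in> to_residue p s r \<longleftrightarrow> of_nat (p ^ s) dvd y - (r :: 'r::comm_ring_1)"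
  unfolding to_residue_def pow_ideal_def cgenideal_def a_r_coset_def r_coset_def
  by (auto simp: ring_of_type_algebra_def dvd_def algebra_simps)

lemma to_residue_hom:
  "to_residue p s \<in> ring_hom base_ring (residue_quot p s :: 'r::comm_ring_1 set ring)"
  unfolding residue_quot_def to_residue_def[abs_def]
  by (rule ideal.rcos_ring_hom[OF pow_ideal_ideal])

lemma carrier_residue_quot:
  "carrier (residue_quot p s :: 'r::comm_ring_1 set ring) = range (to_residue p s)"
  by (auto simp: residue_quot_def FactRing_def A_RCOSETS_def RCOSETS_def to_residue_def[abs_def]
      a_r_coset_def ring_of_type_algebra_def)

lemma residue_ops:
  fixes a b :: "'r::comm_ring_1"
  shows "to_residue p s a \<oplus>\<^bsub>residue_quot p s\<^esub> to_residue p s b = to_residue p s (a + b)"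
    "to_residue p s a \<otimes>\<^bsub>residue_quot p s\<^esub> to_residue p s b = to_residue p s (a * b)"
    "\<one>\<^bsub>residue_quot p s\<^esub> = to_residue p s (1::'r)"
    "\<zero>\<^bsub>residue_quot p s\<^esub> = to_residue p s (0::'r)"
proof -
  interpret cring "residue_quot p s :: 'r set ring" by (rule cring_residue_quot)
  note h = to_residue_hom[of p s, where 'r='r]
  show "to_residue p s a \<oplus>\<^bsub>residue_quot p s\<^esub> to_residue p s b = to_residue p s (a + b)"
    "to_residue p s a \<otimes>\<^bsub>residue_quot p s\<^esub> to_residue p s b = to_residue p s (a * b)"
    "\<one>\<^bsub>residue_quot p s\<^esub> = to_residue p s (1::'r)"
    using ring_hom_add[OF h, of a b] ring_hom_mult[OF h, of a b] ring_hom_one[OF h]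
    by (simp_all add: ring_of_type_algebra_def)
  show "\<zero>\<^bsub>residue_quot p s\<^esub> = to_residue p s (0::'r)"
    using ring_hom_zero[OF h ring_from_type_algebra ring_axioms] by (simp add: ring_of_type_algebra_def)
qed

lemma to_residue_subset:
  "to_residue p (Suc s) a \<subseteq> to_residue p s b \<longleftrightarrow> of_nat (p ^ s) dvd a - (b :: 'r::comm_ring_1)"
proof
  assume "to_residue p (Suc s) a \<subseteq> to_residue p s b"
  moreover have "a \<in> to_residue p (Suc s) a" by (simp add: mem_to_residue)
  ultimately show "of_nat (p ^ s) dvd a - b" using mem_to_residue by blast
next
  assume d: "of_nat (p ^ s) dvd a - b"
  show "to_residue p (Suc s) a \<subseteq> to_residue p s b"
  proof
    fix y assume "y \<in> to_residue p (Suc s) a"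
    then have "of_nat (p ^ Suc s) dvd y - a" by (simp only: mem_to_residue)
    then have "of_nat (p ^ s) dvd y - a" by (metis dvd_mult_right of_nat_mult power_Suc)
    from dvd_add[OF this d] show "y \<in> to_residue p s b" by (simp add: mem_to_residue)
  qed
qed

lemma carrier_padic_completion:
  "x \<in> carrier (padic_completion p :: (nat \<Rightarrow> 'r::comm_ring_1 set) ring) \<longleftrightarrow>
    (\<exists>r. x = (\<lambda>s. to_residue p s (r s)) \<and> (\<forall>s. of_nat (p ^ s) dvd r (Suc s) - r s))" (is "?L \<longleftrightarrow> ?R")
proof
  assume ?L
  then have *: "\<forall>s. x s \<in> range (to_residue p s) \<and> x (Suc s) \<subseteq> x s"
    by (simp add: padic_completion_def carrier_residue_quot)
  then have "\<forall>s. \<exists>r. x s = to_residue p s r" by blast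
  then obtain r where r: "\<forall>s. x s = to_residue p s (r s)" by metis
  with * show ?R by (intro exI[of _ r]) (auto simp: to_residue_subset fun_eq_iff simp del: of_nat_power)
next
  assume ?R
  then obtain r where r: "x = (\<lambda>s. to_residue p s (r s))" "\<forall>s. of_nat (p ^ s) dvd r (Suc s) - r s" by blast
  show ?L unfolding r(1) using r(2)
    by (simp add: padic_completion_def carrier_residue_quot to_residue_subset del: of_nat_power)
qed

lemma cring_padic_completion: "cring (padic_completion p :: (nat \<Rightarrow> 'r::comm_ring_1 set) ring)"
proof -
  let ?C = "padic_completion p :: (nat \<Rightarrow> 'r set) ring"
  have ops: "x \<oplus>\<^bsub>?C\<^esub> y = (\<lambda>s. x s \<oplus>\<^bsub>residue_quot p s\<^esub> y s)" "x \<otimes>\<^bsub>?C\<^esub> y = (\<lambda>s. x s \<otimes>\<^bsub>residue_quot p s\<^esub> y s)"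
    "\<one>\<^bsub>?C\<^esub> = (\<lambda>s. to_residue p s 1)" "\<zero>\<^bsub>?C\<^esub> = (\<lambda>s. to_residue p s 0)" for x y
    by (simp_all add: padic_completion_def residue_ops)
  have one: "\<one>\<^bsub>?C\<^esub> \<in> carrier ?C" and zero: "\<zero>\<^bsub>?C\<^esub> \<in> carrier ?C"
    by (auto simp: carrier_padic_completion ops)
  have add: "x \<oplus>\<^bsub>?C\<^esub> y \<in> carrier ?C" and mult: "x \<otimes>\<^bsub>?C\<^esub> y \<in> carrier ?C"
    if "x \<in> carrier ?C" "y \<in> carrier ?C" for x y
  proof -
    from that obtain a b where a: "x = (\<lambda>s. to_residue p s (a s))" "\<forall>s. of_nat (p ^ s) dvd a (Suc s) - a s"
      and b: "y = (\<lambda>s. to_residue p s (b s))" "\<forall>s. of_nat (p ^ s) dvd b (Suc s) - b s"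
      unfolding carrier_padic_completion by blast
    have "of_nat (p ^ s) dvd (a (Suc s) + b (Suc s)) - (a s + b s)" for s
      using dvd_add[OF a(2)[rule_format, of s] b(2)[rule_format, of s]] by (simp add: algebra_simps)
    then show "x \<oplus>\<^bsub>?C\<^esub> y \<in> carrier ?C" unfolding carrier_padic_completion
      by (intro exI[of _ "\<lambda>s. a s + b s"]) (simp add: ops a b residue_ops)
    have "of_nat (p ^ s) dvd (a (Suc s) * b (Suc s)) - (a s * b s)" for s
      using dvd_add[OF dvd_mult2[OF a(2)[rule_format, of s], of "b (Suc s)"]
          dvd_mult[OF b(2)[rule_format, of s], of "a s"]] by (simp add: algebra_simps)
    then show "x \<otimes>\<^bsub>?C\<^esub> y \<in> carrier ?C" unfolding carrier_padic_completion
      by (intro exI[of _ "\<lambda>s. a s * b s"]) (simp add: ops a b residue_ops)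
  qed
  have inv: "\<exists>y\<in>carrier ?C. y \<oplus>\<^bsub>?C\<^esub> x = \<zero>\<^bsub>?C\<^esub>" if x: "x \<in> carrier ?C" for x
  proof -
    from x obtain a where a: "x = (\<lambda>s. to_residue p s (a s))" "\<forall>s. of_nat (p ^ s) dvd a (Suc s) - a s"
      unfolding carrier_padic_completion by blast
    have "of_nat (p ^ s) dvd - a (Suc s) - - a s" for s
      using a(2)[rule_format, of s] by (metis dvd_minus_iff minus_diff_minus)
    then show ?thesis
      by (intro bexI[of _ "\<lambda>s. to_residue p s (- a s)"])
        (auto simp: ops a residue_ops carrier_padic_completion intro!: exI[of _ "\<lambda>s. - a s"])
  qed
  show ?thesis
    by (intro cringI abelian_groupI comm_monoidI add mult one zero inv)
      (auto simp: carrier_padic_completion ops residue_ops algebra_simps)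
qed

lemma to_completion_hom:
  "to_completion p \<in> ring_hom base_ring (padic_completion p :: (nat \<Rightarrow> 'r::comm_ring_1 set) ring)"
  by (rule ring_hom_memI)
    (auto simp: carrier_padic_completion to_completion_def[abs_def], 
     auto simp: padic_completion_def residue_ops ring_of_type_algebra_def)

lemma hasse_witt_0: "hasse_witt p f 0 = mat_one base_ring"
  by (auto simp: hasse_witt_def mat_one_def fun_eq_iff lookup_one ring_of_type_algebra_def)

lemma finite_interior_points: "finite (interior_points f)"
proof -
  have "bounded (newton_polytope f)" unfolding newton_polytope_def
    by (intro bounded_convex_hull finite_imp_bounded) simp
  then obtain B where B: "\<And>x. x \<in> newton_polytope f \<Longrightarrow> norm x \<le> B" by (auto simp: bounded_iff)
  have "\<bar>vec_nth u i\<bar> \<le> \<lceil>B\<rceil>" if "u \<in> interior_points f" for u i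
  proof -
    have "norm (real_point u) \<le> B" using that B interior_subset by (auto simp: interior_points_def)
    then have "\<bar>real_of_int (vec_nth u i)\<bar> \<le> B"
      using component_le_norm_cart[of "real_point u" i] by (simp add: real_point_def)
    then show ?thesis by linarith
  qed
  then have "vec_nth ` interior_points f \<subseteq> (UNIV \<rightarrow>\<^sub>E {-\<lceil>B\<rceil>..\<lceil>B\<rceil>})"
    by (auto simp: abs_le_iff) (smt (verit, best))+
  then have "finite (vec_nth ` interior_points f)"
    by (rule finite_subset) (auto intro: finite_PiE)
  then show ?thesis by (rule finite_imageD) (auto intro: injI simp: vec_eq_iff inj_on_def)
qed

end

theory Submission
  imports Defs
begin

text \<open>
  Let \<open>F\<^sub>s = f\<^bsup>p^s - 1\<^esup>\<close> and let \<open>\<phi>\<^sub>k\<close> apply \<open>\<sigma>\<^sup>k\<close> to coefficients and raise the variables to the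
  power \<open>p\<^sup>k\<close>. Define Laurent polynomials \<open>I\<^sub>k\<close> recursively by
  \<open>F\<^sub>s = \<Sum>\<^bsub>1 \<le> k \<le> s\<^esub> I\<^sub>k \<phi>\<^sub>k(F\<^bsub>s-k\<^esub>)\<close>. Writing \<open>F\<^sub>s = F\<^bsub>s-1\<^esub> h\<^bsup>p^(s-1)\<^esup>\<close> with \<open>h = f\<^bsup>p-1\<^esup>\<close> and comparing the
  decompositions of both sides, the congruence \<open>\<phi>\<^sub>k(h)\<^bsup>p^n\<^esup> \<equiv> h\<^bsup>p^(n+k)\<^esup> mod p\<^bsup>n+1\<^esup>\<close> shows by
  induction that \<open>p\<^bsup>k-1\<^esup>\<close> divides \<open>I\<^sub>k\<close>. Since \<open>I\<^sub>k\<close> is supported in \<open>(p\<^sup>k - 1)\<Delta>(f)\<close>, extracting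
  coefficients gives \<open>\<alpha>\<^sub>s = \<Sum>\<^bsub>1 \<le> k \<le> s\<^esub> \<beta>\<^sub>k \<sigma>\<^sup>k(\<alpha>\<^bsub>s-k\<^esub>)\<close> with \<open>p\<^bsup>k-1\<^esup>\<close> dividing \<open>\<beta>\<^sub>k\<close>, and all three
  claims follow from this recursion by induction; for (iii) one also uses that \<open>D \<circ> \<sigma>\<^sup>m\<close> takes
  values in \<open>p\<^sup>mR\<close>. Inverses over the completion are handled through matrices over \<open>R\<close> that are
  inverse modulo a fixed power of \<open>p\<close>.
\<close>

subsection \<open>Ring endomorphisms, Frobenius lifts and derivations\<close>

locale ring_endo =
  fixes \<tau> :: "'r::comm_ring_1 \<Rightarrow> 'r"
  assumes map_one: "\<tau> 1 = 1"
    and map_add: "\<tau> (a + b) = \<tau> a + \<tau> b"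
    and map_mult: "\<tau> (a * b) = \<tau> a * \<tau> b"
begin

lemma map_zero: "\<tau> 0 = 0"
  using map_add[of 0 0] by simp

lemma map_diff: "\<tau> (a - b) = \<tau> a - \<tau> b"
  using map_add[of "a - b" b] by (simp add: algebra_simps)

lemma map_sum: "\<tau> (sum g A) = (\<Sum>x\<in>A. \<tau> (g x))"
  by (induction A rule: infinite_finite_induct) (auto simp: map_zero map_add)

lemma map_of_nat: "\<tau> (of_nat n) = of_nat n"
  by (induction n) (auto simp: map_zero map_one map_add)

lemma map_power: "\<tau> (a ^ n) = \<tau> a ^ n"
  by (induction n) (auto simp: map_one map_mult)

lemma of_nat_dvd_map: "of_nat n dvd a \<Longrightarrow> of_nat n dvd \<tau> a"
  by (auto simp: dvd_def map_mult map_of_nat)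

end

lemma ring_endo_funpow: "ring_endo \<tau> \<Longrightarrow> ring_endo (\<tau> ^^ k)"
  by (induction k) (auto simp: ring_endo_def)

lemma frobenius_endo_ring_endo: "frobenius_endo p \<sigma> \<Longrightarrow> ring_endo \<sigma>"
  by (auto simp: frobenius_endo_def ring_endo_def ring_hom_def ring_of_type_algebra_def)

lemma frobenius_endo_dvd: "frobenius_endo p \<sigma> \<Longrightarrow> of_nat p dvd \<sigma> r - r ^ p"
  by (simp add: frobenius_endo_def)

lemma derivation_zero: "is_derivation D \<Longrightarrow> D 0 = 0"
  unfolding is_derivation_def by (metis add.right_neutral add_left_cancel)

lemma derivation_one: "is_derivation D \<Longrightarrow> D 1 = 0"
  unfolding is_derivation_def by (metis add.right_neutral add_left_cancel mult_1 mult_1_right)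

lemma derivation_add: "is_derivation D \<Longrightarrow> D (a + b) = D a + D b"
  and derivation_mult: "is_derivation D \<Longrightarrow> D (a * b) = D a * b + a * D b"
  by (simp_all add: is_derivation_def)

lemma derivation_sum: "is_derivation D \<Longrightarrow> D (sum g A) = (\<Sum>x\<in>A. D (g x))"
  by (induction A rule: infinite_finite_induct) (auto simp: derivation_zero derivation_add)

lemma derivation_of_nat: "is_derivation D \<Longrightarrow> D (of_nat n) = 0"
  by (induction n) (auto simp: derivation_zero derivation_one derivation_add)

lemma derivation_of_nat_mult: "is_derivation D \<Longrightarrow> D (of_nat n * a) = of_nat n * D a"
  by (simp add: derivation_mult derivation_of_nat)

lemma derivation_power: "is_derivation D \<Longrightarrow> D (a ^ Suc n) = of_nat (Suc n) * a ^ n * D a"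
  by (induction n) (simp_all add: derivation_mult algebra_simps)

text \<open>Put z = \<sigma>^m(x) and \<sigma>(x) = x^p + p y. Then \<sigma>^(m+1)(x) = z^p + p
  \<sigma>^m(y), and D turns z^p into p z^(p-1) D(z). Each further application of \<sigma> therefore
  gains one factor p.\<close>

lemma dvd_derivation_frobenius_funpow:
  fixes D :: "'r::comm_ring_1 \<Rightarrow> 'r"
  assumes D: "is_derivation D" and \<sigma>: "frobenius_endo p \<sigma>" and p: "p > 0"
  shows "of_nat (p ^ m) dvd D ((\<sigma> ^^ m) x)"
proof (induction m arbitrary: x)
  case (Suc m)
  interpret \<tau>: ring_endo "\<sigma> ^^ m"
    by (intro ring_endo_funpow frobenius_endo_ring_endo[OF \<sigma>])
  obtain y where "\<sigma> x - x ^ p = of_nat p * y"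
    using frobenius_endo_dvd[OF \<sigma>, of x] by (auto simp: dvd_def)
  then have "\<sigma> x = x ^ p + of_nat p * y" by (simp add: algebra_simps)
  then have "(\<sigma> ^^ Suc m) x = ((\<sigma> ^^ m) x) ^ p + of_nat p * (\<sigma> ^^ m) y"
    by (simp add: funpow_swap1 \<tau>.map_add \<tau>.map_mult \<tau>.map_power \<tau>.map_of_nat)
  then have "D ((\<sigma> ^^ Suc m) x) = of_nat p * (((\<sigma> ^^ m) x) ^ (p - 1) * D ((\<sigma> ^^ m) x) + D ((\<sigma> ^^ m) y))"
    using derivation_power[OF D, of "(\<sigma> ^^ m) x" "p - 1"] p
    by (simp add: derivation_add[OF D] derivation_of_nat_mult[OF D] algebra_simps)
  moreover have "of_nat (p ^ m) dvd ((\<sigma> ^^ m) x) ^ (p - 1) * D ((\<sigma> ^^ m) x) + D ((\<sigma> ^^ m) y)"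
    using Suc by (intro dvd_add dvd_mult)
  ultimately show ?case by (simp add: mult_dvd_mono)
qed simp


lemma of_nat_dvd_mono: "k dvd n \<Longrightarrow> (of_nat k :: 'r::comm_semiring_1) dvd of_nat n"
  by (auto simp: dvd_def)


subsection \<open>Congruences of matrices\<close>

text \<open>This lemma and those up to \<open>mat_one_base_ring\<close> translate the record
  operations of \<open>base_ring\<close> into \<open>sum\<close>, \<open>-\<close>,
  \<open>of_nat\<close> and \<open>dvd\<close>, so that the arguments over R take place in the type
  class.\<close>

lemma finsum_base_ring: "finite K \<Longrightarrow> finsum base_ring g K = sum g K" for g :: "'i \<Rightarrow> 'r::comm_ring_1"
proof (induction K rule: finite_induct)
  interpret cring "base_ring :: 'r ring" by (rule cring_from_type_algebra)
  case empty show ?case by simp (simp add: ring_of_type_algebra_def)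
next
  interpret cring "base_ring :: 'r ring" by (rule cring_from_type_algebra)
  case (insert x F)
  then show ?case by (subst finsum_insert) (auto simp: ring_of_type_algebra_def)
qed

lemma minus_base_ring: "a \<ominus>\<^bsub>base_ring\<^esub> b = a - (b :: 'r::comm_ring_1)"
proof -
  interpret cring "base_ring :: 'r ring" by (rule cring_from_type_algebra)
  have "\<ominus>\<^bsub>base_ring\<^esub> b = - b"
    by (rule minus_equality) (auto simp: ring_of_type_algebra_def)
  then show ?thesis by (simp add: a_minus_def) (simp add: ring_of_type_algebra_def)
qed

lemma add_pow_base_ring: "[n] \<cdot>\<^bsub>base_ring\<^esub> \<one>\<^bsub>base_ring\<^esub> = (of_nat n :: 'r::comm_ring_1)"
proof -
  interpret cring "base_ring :: 'r ring" by (rule cring_from_type_algebra)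
  show ?thesis
    by (induction n) (simp_all add: add.nat_pow_Suc, simp_all add: ring_of_type_algebra_def)
qed

lemma mem_PIdl_base_ring: "x \<in> PIdl\<^bsub>base_ring\<^esub> a \<longleftrightarrow> a dvd (x :: 'r::comm_ring_1)"
  by (auto simp: cgenideal_def ring_of_type_algebra_def dvd_def mult.commute)

lemma mat_cong_base_ring:
  "mat_cong base_ring J n A B \<longleftrightarrow> (\<forall>u\<in>J. \<forall>v\<in>J. of_nat n dvd A u v - (B u v :: 'r::comm_ring_1))"
  by (simp add: mat_cong_def mem_PIdl_base_ring add_pow_base_ring minus_base_ring)

lemma mat_one_base_ring: "mat_one base_ring u v = (if u = v then 1 else 0 :: 'r::comm_ring_1)"
  by (simp add: mat_one_def ring_of_type_algebra_def)

locale finite_index =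
  fixes J :: "'i set"
  assumes finite_J: "finite J"
begin

abbreviation mat_times :: "('i, 'r::comm_ring_1) matr \<Rightarrow> ('i, 'r) matr \<Rightarrow> ('i, 'r) matr" (infixl \<open>\<star>\<close> 70)
  where "A \<star> B \<equiv> mat_mult base_ring J A B"

abbreviation mcong :: "nat \<Rightarrow> ('i, 'r::comm_ring_1) matr \<Rightarrow> ('i, 'r) matr \<Rightarrow> bool"
  where "mcong \<equiv> mat_cong base_ring J"

abbreviation (input) mone :: "('i, 'r::comm_ring_1) matr"
  where "mone \<equiv> mat_one base_ring"

text \<open>Invertibility of A over R/nR, expressed with matrices over R. It replaces determinants
  and quotient rings in the inductions.\<close>

definition inverse_mod :: "nat \<Rightarrow> ('i, 'r::comm_ring_1) matr \<Rightarrow> ('i, 'r) matr \<Rightarrow> bool"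
  where "inverse_mod n A B \<longleftrightarrow> mcong n (A \<star> B) mone \<and> mcong n (B \<star> A) mone"

lemma mat_times_apply: "(A \<star> B) u v = (\<Sum>w\<in>J. A u w * B w v)"
  by (simp add: mat_mult_def finsum_base_ring finite_J) (simp add: ring_of_type_algebra_def)

lemma mat_times_assoc: "A \<star> B \<star> C = A \<star> (B \<star> C)"
  by (simp add: fun_eq_iff mat_times_apply sum_distrib_left sum_distrib_right mult.assoc)
    (intro allI, rule sum.swap)

lemma mcong_refl [simp]: "mcong n A A"
  by (simp add: mat_cong_base_ring)

lemma mcong_sym: "mcong n A B \<Longrightarrow> mcong n B A"
  unfolding mat_cong_base_ring by (metis dvd_minus_iff minus_diff_eq)

lemma mcong_trans [trans]: "mcong n A B \<Longrightarrow> mcong n B C \<Longrightarrow> mcong n A C"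
  unfolding mat_cong_base_ring by (metis diff_add_cancel dvd_add add_diff_eq)

lemma mcong_mono: "mcong n A B \<Longrightarrow> k dvd n \<Longrightarrow> mcong k A B"
  unfolding mat_cong_base_ring by (meson dvd_trans of_nat_dvd_mono)

lemma mcong_times:
  assumes "mcong n A A'" "mcong n B B'"
  shows "mcong n (A \<star> B) (A' \<star> B')"
proof -
  have "A u w * B w v - A' u w * B' w v = (A u w - A' u w) * B w v + A' u w * (B w v - B' w v)" for u w v
    by (simp add: algebra_simps)
  then show ?thesis
    using assms unfolding mat_cong_base_ring mat_times_apply
    by (auto simp flip: sum_subtractf intro!: dvd_sum dvd_add)
qed

text \<open>The source of every gain in precision: a factor \<beta>_k divisible by p^(k-1) lifts a
  congruence modulo p^(s+1-k) to one modulo p^s.\<close>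

lemma mcong_times_scaled:
  assumes "\<And>u v. u \<in> J \<Longrightarrow> v \<in> J \<Longrightarrow> of_nat k dvd A u v" "mcong n B B'"
  shows "mcong (k * n) (A \<star> B) (A \<star> B')"
  using assms unfolding mat_cong_base_ring mat_times_apply
  by (auto simp flip: sum_subtractf right_diff_distrib intro!: dvd_sum mult_dvd_mono)

lemma mcong_sum:
  "(\<And>k. k \<in> K \<Longrightarrow> mcong n (A k) (B k)) \<Longrightarrow> mcong n (\<lambda>u v. \<Sum>k\<in>K. A k u v) (\<lambda>u v. \<Sum>k\<in>K. B k u v)"
  unfolding mat_cong_base_ring by (auto simp flip: sum_subtractf intro!: dvd_sum)

lemma sum_mat_times: "(\<lambda>u v. \<Sum>k\<in>K. A k u v) \<star> B = (\<lambda>u v. \<Sum>k\<in>K. (A k \<star> B) u v)"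
  by (simp add: fun_eq_iff mat_times_apply sum_distrib_right) (intro allI, rule sum.swap)

lemma mcong_one_times: "mcong n (mone \<star> A) A" and mcong_times_one: "mcong n (A \<star> mone) A"
  by (simp_all add: mat_cong_base_ring mat_times_apply mat_one_base_ring finite_J if_distrib if_distribR
      sum.delta sum.delta' cong: if_cong)

lemma mat_map_times: "ring_endo \<tau> \<Longrightarrow> mat_map \<tau> (A \<star> B) = mat_map \<tau> A \<star> mat_map \<tau> B"
  by (simp add: fun_eq_iff mat_map_def mat_times_apply ring_endo.map_sum ring_endo.map_mult)

lemma mat_map_one: "ring_endo \<tau> \<Longrightarrow> mat_map \<tau> mone = mone"
  by (simp add: fun_eq_iff mat_map_def mat_one_base_ring ring_endo.map_one ring_endo.map_zero)

lemma mcong_map: "ring_endo \<tau> \<Longrightarrow> mcong n A B \<Longrightarrow> mcong n (mat_map \<tau> A) (mat_map \<tau> B)"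
  unfolding mat_cong_base_ring mat_map_def
  by (metis ring_endo.map_diff ring_endo.of_nat_dvd_map)

section \<open>Matrices invertible modulo an integer\<close>

lemma inverse_mod_sym: "inverse_mod n A B \<Longrightarrow> inverse_mod n B A"
  by (auto simp: inverse_mod_def)

lemma inverse_mod_mono: "inverse_mod n A B \<Longrightarrow> k dvd n \<Longrightarrow> inverse_mod k A B"
  by (auto simp: inverse_mod_def intro: mcong_mono)

lemma inverse_mod_map: "ring_endo \<tau> \<Longrightarrow> inverse_mod n A B \<Longrightarrow> inverse_mod n (mat_map \<tau> A) (mat_map \<tau> B)"
  unfolding inverse_mod_def by (metis mat_map_one mat_map_times mcong_map)

lemma inverse_mod_one: "inverse_mod n mone mone"
  by (simp add: inverse_mod_def mcong_one_times)

lemma mcong_cancel_left: "inverse_mod n A B \<Longrightarrow> mcong n (B \<star> (A \<star> C)) C"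
  using mcong_times[OF _ mcong_refl[of n C], of "B \<star> A" mone] mcong_one_times[of n C]
  unfolding inverse_mod_def mat_times_assoc by (blast intro: mcong_trans)

lemma mcong_cancel_right: "inverse_mod n A B \<Longrightarrow> mcong n (C \<star> A \<star> B) C"
  using mcong_times[OF mcong_refl[of n C], of "A \<star> B" mone] mcong_times_one[of n C]
  unfolding inverse_mod_def mat_times_assoc by (blast intro: mcong_trans)

lemma inverse_mod_times:
  assumes "inverse_mod n A B" "inverse_mod n A' B'"
  shows "inverse_mod n (A \<star> A') (B' \<star> B)"
proof -
  have "mcong n (A \<star> A' \<star> B' \<star> B) (A \<star> B)"
    by (intro mcong_times mcong_cancel_right assms) simp
  moreover have "mcong n (B' \<star> (B \<star> (A \<star> A'))) (B' \<star> A')"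
    by (intro mcong_times mcong_cancel_left assms) simp
  ultimately show ?thesis
    using assms unfolding inverse_mod_def mat_times_assoc by (blast intro: mcong_trans)
qed

lemma inverse_mod_cong: "inverse_mod n A B \<Longrightarrow> mcong n A A' \<Longrightarrow> inverse_mod n A' B"
  unfolding inverse_mod_def by (meson mcong_refl mcong_sym mcong_times mcong_trans)

text \<open>B = B 1 \<equiv> B A B' \<equiv> 1 B' = B'. With A = A' this is uniqueness; in general
  it carries a congruence over to the inverses.\<close>

lemma inverse_mod_unique:
  assumes "inverse_mod n A B" "inverse_mod n A' B'" "mcong n A A'"
  shows "mcong n B B'"
proof -
  have "mcong n B (B \<star> A \<star> B')"
    using mcong_sym[OF mcong_cancel_right[OF inverse_mod_cong[OF assms(2) mcong_sym[OF assms(3)]], of B]]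
    by simp
  also have "mcong n \<dots> B'"
    using mcong_cancel_left[OF assms(1), of B'] by (simp add: mat_times_assoc)
  finally show ?thesis .
qed

text \<open>One Newton step: with \<open>B' = 2B - BAB\<close> one has \<open>AB' - 1 = -(AB - 1)\<^sup>2\<close>, and likewise on the
  other side.\<close>

lemma inverse_mod_square:
  assumes "inverse_mod n A B"
  shows "\<exists>B'. inverse_mod (n * n) A B'"
proof -
  define P where "P = (\<lambda>u v. (A \<star> B) u v - mone u v)"
  define Q where "Q = (\<lambda>u v. (B \<star> A) u v - mone u v)"
  define B' where "B' = (\<lambda>u v. 2 * B u v - (B \<star> A \<star> B) u v)"
  have one: "(\<Sum>w\<in>J. mone u w * M w v) = M u v" "(\<Sum>w\<in>J. M u w * mone w v) = M u v"
    if "u \<in> J" "v \<in> J" for u v M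
    using that finite_J
    by (simp_all add: mat_one_base_ring if_distrib if_distribR sum.delta sum.delta' cong: if_cong)
  have "(P \<star> P) u v = mone u v - (A \<star> B') u v" and "(Q \<star> Q) u v = mone u v - (B' \<star> A) u v"
    if u: "u \<in> J" and v: "v \<in> J" for u v
  proof -
    have "(P \<star> P) u v = (A \<star> B \<star> (A \<star> B)) u v - 2 * (A \<star> B) u v + mone u v"
      using u v by (simp add: P_def mat_times_apply[of "\<lambda>u v. _ u v - _ u v"] left_diff_distrib
          right_diff_distrib sum_subtractf one mat_times_apply[of "_ \<star> _" "_ \<star> _"])
    moreover have "(A \<star> B') u v = 2 * (A \<star> B) u v - (A \<star> (B \<star> A \<star> B)) u v"
      by (simp add: B'_def mat_times_apply[of _ "\<lambda>u v. _ u v - _ u v"] right_diff_distrib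
          sum_subtractf mat_times_apply[of A B] mat_times_apply[of A "_ \<star> _"] sum_distrib_left mult.left_commute)
    ultimately show "(P \<star> P) u v = mone u v - (A \<star> B') u v"
      by (simp add: mat_times_assoc)
    have "(Q \<star> Q) u v = (B \<star> A \<star> (B \<star> A)) u v - 2 * (B \<star> A) u v + mone u v"
      using u v by (simp add: Q_def mat_times_apply[of "\<lambda>u v. _ u v - _ u v"] left_diff_distrib
          right_diff_distrib sum_subtractf one mat_times_apply[of "_ \<star> _" "_ \<star> _"])
    moreover have "(B' \<star> A) u v = 2 * (B \<star> A) u v - (B \<star> A \<star> B \<star> A) u v"
      by (simp add: B'_def mat_times_apply[of "\<lambda>u v. _ u v - _ u v"] left_diff_distrib
          sum_subtractf mat_times_apply[of B A] mat_times_apply[of "_ \<star> _" A] sum_distrib_left mult.assoc)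
    ultimately show "(Q \<star> Q) u v = mone u v - (B' \<star> A) u v"
      by (simp add: mat_times_assoc)
  qed
  moreover have "of_nat (n * n) dvd (P \<star> P) u v" "of_nat (n * n) dvd (Q \<star> Q) u v"
    if "u \<in> J" "v \<in> J" for u v
    using assms that unfolding inverse_mod_def mat_cong_base_ring mat_times_apply[of P] mat_times_apply[of Q]
      of_nat_mult by (auto intro!: dvd_sum mult_dvd_mono simp: P_def Q_def)
  ultimately have "inverse_mod (n * n) A B'"
    unfolding inverse_mod_def mat_cong_base_ring by (metis dvd_minus_iff minus_diff_eq)
  then show ?thesis by blast
qed

lemma inverse_mod_power:
  assumes "inverse_mod n A B"
  shows "\<exists>B'. inverse_mod (n ^ N) A B'"
proof (induction N)
  case 0
  then show ?case by (simp add: inverse_mod_def mat_cong_base_ring)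
next
  case (Suc N)
  show ?case
  \<comment> \<open>Squaring the modulus n^N reaches n^(N+1) only if N \<ge> 1; the step from
    exponent 0 to 1 is the assumption itself.\<close>
  proof (cases N)
    case 0
    then show ?thesis using assms by auto
  next
    case (Suc k)
    with Suc.IH obtain B' where "inverse_mod (n ^ N * n ^ N) A B'"
      using inverse_mod_square by blast
    moreover have "n ^ Suc N dvd n ^ N * n ^ N"
      unfolding power_add[symmetric] using Suc by (intro le_imp_power_dvd) simp
    ultimately show ?thesis using inverse_mod_mono by blast
  qed
qed

end


subsection \<open>Matrix sequences with a Frobenius recursion\<close>

text \<open>The abstract setting for all three claims: \<open>a\<close> stands for the matrices
  \<alpha>_s and \<beta>_k for the matrix of coefficients of I_k. Nothing else about the Laurent
  polynomial enters from here on.\<close>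

locale frobenius_recursion = finite_index J
  for J :: "'i set" +
  fixes p :: nat and \<sigma> :: "'r::comm_ring_1 \<Rightarrow> 'r" and a \<beta> :: "nat \<Rightarrow> ('i, 'r) matr"
  assumes p_pos: "p > 0"
    and frobenius: "frobenius_endo p \<sigma>"
    and a_0: "a 0 = mat_one base_ring"
    and a_rec: "s > 0 \<Longrightarrow> u \<in> J \<Longrightarrow> v \<in> J \<Longrightarrow>
      a s u v = (\<Sum>k\<in>{1..s}. mat_mult base_ring J (\<beta> k) (mat_map (\<sigma> ^^ k) (a (s - k))) u v)"
    and \<beta>_dvd: "k > 0 \<Longrightarrow> u \<in> J \<Longrightarrow> v \<in> J \<Longrightarrow> of_nat (p ^ (k - 1)) dvd \<beta> k u v"
begin

abbreviation frob :: "nat \<Rightarrow> ('i, 'r) matr \<Rightarrow> ('i, 'r) matr"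
  where "frob k \<equiv> mat_map (\<sigma> ^^ k)"

lemma endo: "ring_endo (\<sigma> ^^ k)"
  by (intro ring_endo_funpow frobenius_endo_ring_endo[OF frobenius])

lemma frob_frob: "frob k (frob j A) = frob (k + j) A"
  by (simp add: mat_map_def funpow_add)

lemma frob_0: "frob 0 A = A"
  by (simp add: mat_map_def)

lemma mcong_zero_times:
  assumes "\<And>u v. u \<in> J \<Longrightarrow> v \<in> J \<Longrightarrow> of_nat n dvd A u v"
  shows "mcong n (A \<star> B) (\<lambda>u v. 0)"
  using assms unfolding mat_cong_base_ring mat_times_apply by (auto intro!: dvd_sum)

text \<open>The term k = s+1 of the recursion carries the factor p^s and drops out.\<close>

lemma a_rec_truncated:
  "mcong (p ^ s) (a (Suc s)) (\<lambda>u v. \<Sum>k\<in>{1..s}. (\<beta> k \<star> frob k (a (Suc s - k))) u v)"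
proof -
  have "of_nat (p ^ s) dvd (\<beta> (Suc s) \<star> frob (Suc s) (a 0)) u v" if "u \<in> J" "v \<in> J" for u v
    using mcong_zero_times[OF \<beta>_dvd[of "Suc s"]] that by (simp add: mat_cong_base_ring)
  then show ?thesis
    by (simp add: mat_cong_base_ring a_rec sum.nat_ivl_Suc')
qed

text \<open>For s = 1 the recursion reads a_1 = \<beta>_1 \<sigma>(1) = \<beta>_1. The equality
  holds on J only, hence the form of a congruence for every n.\<close>

lemma mcong_\<beta>_1: "mcong n (\<beta> 1) (a 1)"
proof -
  have "mcong n (\<beta> 1 \<star> mone) (\<beta> 1)" by (rule mcong_times_one)
  moreover have "mcong n (\<beta> 1 \<star> mone) (a 1)"
    using a_rec[of 1] by (auto simp: mat_cong_base_ring a_0 mat_map_one[OF endo[of 1], simplified])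
  ultimately show ?thesis by (blast intro: mcong_trans mcong_sym)
qed

text \<open>For k \<ge> 2 the matrix \<beta>_k is divisible by p, so only the term k = 1
  survives.\<close>

lemma a_Suc_mod_p: "mcong p (a (Suc s)) (a 1 \<star> frob 1 (a s))"
proof -
  let ?M = "\<lambda>k. \<beta> k \<star> frob k (a (Suc s - k))"
  have "mcong p (a (Suc s)) (\<lambda>u v. \<Sum>k\<in>{1..Suc s}. ?M k u v)"
    by (simp add: mat_cong_base_ring a_rec del: sum.cl_ivl_Suc)
  also have "mcong p \<dots> (\<lambda>u v. \<Sum>k\<in>{1..Suc s}. if k = 1 then ?M 1 u v else 0)"
  proof (rule mcong_sum)
    fix k assume k: "k \<in> {1..Suc s}"
    show "mcong p (?M k) (\<lambda>u v. if k = 1 then ?M 1 u v else 0)"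
    proof (cases "k = 1")
      case False
      with k have "p dvd p ^ (k - 1)" by (intro dvd_power) auto
      moreover have "mcong (p ^ (k - 1)) (?M k) (\<lambda>u v. 0)"
        using k by (intro mcong_zero_times \<beta>_dvd) auto
      ultimately show ?thesis using False mcong_mono by auto
    qed simp
  qed
  also have "(\<lambda>u v. \<Sum>k\<in>{1..Suc s}. if k = 1 then ?M 1 u v else 0) = ?M 1"
    by (simp add: sum.delta del: sum.cl_ivl_Suc)
  also have "mcong p (?M 1) (a 1 \<star> frob 1 (a s))"
    using mcong_\<beta>_1 by (intro mcong_times) auto
  finally show ?thesis .
qed

text \<open>\<open>mat_prod\<close> adds factors on the right, whereas \<open>a_Suc_mod_p\<close>
  splits off a factor on the left. A congruence is stated because the unit laws hold only on
  J.\<close>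

lemma mat_prod_Suc_left:
  "mcong n (mat_prod base_ring J (\<lambda>i. frob i A) (Suc s)) (A \<star> frob 1 (mat_prod base_ring J (\<lambda>i. frob i A) s))"
proof (induction s)
  case 0
  show ?case
    by (simp add: mat_map_one[OF endo[of 1], simplified] frob_0[simplified] mcong_trans[OF mcong_one_times mcong_sym[OF mcong_times_one]])
next
  case (Suc s)
  let ?P = "mat_prod base_ring J (\<lambda>i. frob i A)"
  have "mcong n (?P (Suc s) \<star> frob (Suc s) A) (A \<star> frob 1 (?P s) \<star> frob (Suc s) A)"
    by (intro mcong_times Suc.IH) simp
  then show ?case
    using mat_map_times[OF endo[of 1]] frob_frob[of 1 s A]
    by (simp add: mat_times_assoc)
qed

lemma a_mod_p: "mcong p (a s) (mat_prod base_ring J (\<lambda>i. frob i (a 1)) s)"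
proof (induction s)
  case 0
  then show ?case by (simp add: a_0)
next
  case (Suc s)
  note a_Suc_mod_p[of s]
  also have "mcong p (a 1 \<star> frob 1 (a s)) (a 1 \<star> frob 1 (mat_prod base_ring J (\<lambda>i. frob i (a 1)) s))"
    by (intro mcong_times mcong_map endo Suc.IH) simp
  also note mcong_sym[OF mat_prod_Suc_left]
  finally show ?case .
qed

lemma inverse_mod_p:
  assumes "inverse_mod p (a 1) B"
  shows "\<exists>B'. inverse_mod p (a s) B'"
proof (induction s)
  case 0
  then show ?case using inverse_mod_one by (auto simp: a_0)
next
  case (Suc s)
  then obtain B' where "inverse_mod p (a s) B'" by blast
  then have "inverse_mod p (a 1 \<star> frob 1 (a s)) (frob 1 B' \<star> B)"
    by (intro inverse_mod_times assms inverse_mod_map endo)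
  from inverse_mod_cong[OF this mcong_sym[OF a_Suc_mod_p]] show ?case by blast
qed

end

text \<open>Inverses over the completion are replaced by matrices \<open>b s\<close> over R that are
  inverse modulo one fixed power p^N; each congruence below needs only that N is large
  enough.\<close>

locale invertible_frobenius_recursion = frobenius_recursion J p \<sigma> a \<beta>
  for J :: "'i set" and p and \<sigma> :: "'r::comm_ring_1 \<Rightarrow> 'r" and a \<beta> +
  fixes N :: nat and b :: "nat \<Rightarrow> ('i, 'r) matr"
  assumes ab: "inverse_mod (p ^ N) (a s) (b s)"
begin

lemma inverse_frob: "n \<le> N \<Longrightarrow> inverse_mod (p ^ n) (frob m (a s)) (frob m (b s))"
  by (intro inverse_mod_map endo inverse_mod_mono[OF ab] le_imp_power_dvd)

text \<open>Telescoping: \<sigma>^k(a_(s+1-k)) a_(s+1)^(-1) is the product, for j = k-1 down to 0,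
  of \<sigma>^j(\<sigma>(a_(s-j)) a_(s-j+1)^(-1)). The hypothesis \<open>step\<close> with t = s-j
  replaces each factor modulo p^(s-j), and the least precision, at j = k-1, is p^(s+1-k).\<close>

lemma ratio_frob_cong:
  assumes N: "Suc s \<le> N" and k: "k \<le> s"
    and step: "\<And>t. 1 \<le> t \<Longrightarrow> t \<le> s \<Longrightarrow>
      mcong (p ^ t) (frob 1 (a t) \<star> b (Suc t)) (frob 1 (a (t - 1)) \<star> b t)"
  shows "mcong (p ^ (Suc s - k)) (frob k (a (Suc s - k)) \<star> b (Suc s)) (frob k (a (s - k)) \<star> b s)"
  using k
proof (induction k)
  case 0
  \<comment> \<open>For k = 0 both sides are the identity modulo p^(s+1), which requires s+1 \<le>
    N.\<close>
  have *: "mcong (p ^ Suc s) (a r \<star> b r) mone" for r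
    using inverse_frob[OF N, of 0 r] unfolding inverse_mod_def frob_0 by blast
  show ?case
    using mcong_trans[OF * mcong_sym[OF *]] unfolding frob_0 by simp
next
  case (Suc k)
  define t where "t = s - k"
  have t: "1 \<le> t" "t \<le> s" "s - Suc k = t - 1" "Suc s - Suc k = t" "Suc s - k = Suc t" "s - k = t"
    using Suc.prems by (auto simp: t_def)
  \<comment> \<open>Inserting \<sigma>^k(b_j) \<sigma>^k(a_j) \<equiv> 1 splits off one factor of
    the telescoping product.\<close>
  have expand: "mcong (p ^ t) (frob (Suc k) (a i) \<star> C)
      (frob k (frob 1 (a i) \<star> b j) \<star> (frob k (a j) \<star> C))" for i j C
  proof -
    have "t \<le> N" using t N by simp
    from mcong_cancel_right[OF inverse_mod_sym[OF inverse_frob[OF this]], of "frob (Suc k) (a i)" k j]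
    have "mcong (p ^ t) (frob (Suc k) (a i) \<star> frob k (b j) \<star> frob k (a j) \<star> C) (frob (Suc k) (a i) \<star> C)"
      by (intro mcong_times) simp_all
    from mcong_sym[OF this] show ?thesis
      unfolding mat_map_times[OF endo] frob_frob mat_times_assoc by simp
  qed
  have "mcong (p ^ t) (frob (Suc k) (a t) \<star> b (Suc s))
      (frob k (frob 1 (a t) \<star> b (Suc t)) \<star> (frob k (a (Suc t)) \<star> b (Suc s)))"
    by (rule expand)
  also have "mcong (p ^ t) \<dots> (frob k (frob 1 (a (t - 1)) \<star> b t) \<star> (frob k (a t) \<star> b s))"
  proof (rule mcong_times[OF mcong_map[OF endo step[OF t(1,2)]]])
    have "mcong (p ^ Suc t) (frob k (a (Suc t)) \<star> b (Suc s)) (frob k (a t) \<star> b s)"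
      using Suc by (simp add: t)
    then show "mcong (p ^ t) (frob k (a (Suc t)) \<star> b (Suc s)) (frob k (a t) \<star> b s)"
      by (rule mcong_mono) simp
  qed
  also have "mcong (p ^ t) \<dots> (frob (Suc k) (a (t - 1)) \<star> b s)"
    by (rule mcong_sym[OF expand])
  finally show ?case unfolding t .
qed

text \<open>Both sides are expanded by the recursion and compared term by term: the k-th ratios
  agree modulo p^(s+1-k) and \<beta>_k supplies p^(k-1). The hypothesis \<open>step\<close> is used
  only for t < s, which permits the strong induction in \<open>b_step_cong\<close>.\<close>

lemma a_step_cong_aux:
  assumes N: "s \<le> N" and s: "1 \<le> s"
    and step: "\<And>t. 1 \<le> t \<Longrightarrow> t < s \<Longrightarrow>
      mcong (p ^ t) (frob 1 (a t) \<star> b (Suc t)) (frob 1 (a (t - 1)) \<star> b t)"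
  shows "mcong (p ^ s) (a (Suc s) \<star> frob 1 (b s)) (a s \<star> frob 1 (b (s - 1)))"
proof -
  let ?M = "\<lambda>r k. \<beta> k \<star> frob k (a (r - k))"
  have "mcong (p ^ s) (a (Suc s) \<star> frob 1 (b s)) ((\<lambda>u v. \<Sum>k\<in>{1..s}. ?M (Suc s) k u v) \<star> frob 1 (b s))"
    by (intro mcong_times a_rec_truncated) simp
  also have "\<dots> = (\<lambda>u v. \<Sum>k\<in>{1..s}. (?M (Suc s) k \<star> frob 1 (b s)) u v)"
    by (rule sum_mat_times)
  also have "mcong (p ^ s) \<dots> (\<lambda>u v. \<Sum>k\<in>{1..s}. (?M s k \<star> frob 1 (b (s - 1))) u v)"
  proof (rule mcong_sum)
    fix k assume k: "k \<in> {1..s}"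
    \<comment> \<open>The inverse on the right is \<sigma>(b_s), so one \<sigma> is taken out of the
      whole ratio; this lowers both indices to s-1 and k-1 and keeps the precision s+1-k.\<close>
    have "mcong (p ^ (Suc (s - 1) - (k - 1)))
        (frob (k - 1) (a (Suc (s - 1) - (k - 1))) \<star> b (Suc (s - 1))) (frob (k - 1) (a (s - 1 - (k - 1))) \<star> b (s - 1))"
      by (rule ratio_frob_cong) (use k N step in auto)
    moreover have "Suc (s - 1) - (k - 1) = Suc s - k" "Suc (s - 1) = s" "s - 1 - (k - 1) = s - k" "1 + (k - 1) = k"
      using k by auto
    ultimately have "mcong (p ^ (Suc s - k)) (frob 1 (frob (k - 1) (a (Suc s - k)) \<star> b s))
        (frob 1 (frob (k - 1) (a (s - k)) \<star> b (s - 1)))"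
      by (intro mcong_map endo) simp
    then have "mcong (p ^ (Suc s - k)) (frob k (a (Suc s - k)) \<star> frob 1 (b s)) (frob k (a (s - k)) \<star> frob 1 (b (s - 1)))"
      unfolding mat_map_times[OF endo] frob_frob \<open>1 + (k - 1) = k\<close> .
    with k have "mcong (p ^ (k - 1) * p ^ (Suc s - k)) (\<beta> k \<star> (frob k (a (Suc s - k)) \<star> frob 1 (b s)))
        (\<beta> k \<star> (frob k (a (s - k)) \<star> frob 1 (b (s - 1))))"
      by (intro mcong_times_scaled \<beta>_dvd) auto
    moreover have "k - 1 + (Suc s - k) = s" using k by auto
    ultimately show "mcong (p ^ s) (?M (Suc s) k \<star> frob 1 (b s)) (?M s k \<star> frob 1 (b (s - 1)))"
      by (simp add: mat_times_assoc flip: power_add)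
  qed
  also have "\<dots> = (\<lambda>u v. \<Sum>k\<in>{1..s}. ?M s k u v) \<star> frob 1 (b (s - 1))"
    by (rule sum_mat_times[symmetric])
  also have "mcong (p ^ s) \<dots> (a s \<star> frob 1 (b (s - 1)))"
    using s by (intro mcong_times) (simp_all add: mat_cong_base_ring a_rec)
  finally show ?thesis .
qed

text \<open>The congruence of \<open>a_step_cong_aux\<close> for the inverse matrices, the form in
  which \<open>ratio_frob_cong\<close> consumes it. The two statements support each other in an
  induction on s.\<close>

lemma b_step_cong:
  assumes "1 \<le> s" "s \<le> N"
  shows "mcong (p ^ s) (frob 1 (a s) \<star> b (Suc s)) (frob 1 (a (s - 1)) \<star> b s)"
  using assms
proof (induction s rule: less_induct)
  case (less s)
  \<comment> \<open>The factors change order under inversion, as matrices need not commute.\<close>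
  have inv: "inverse_mod (p ^ s) (a i \<star> frob 1 (b j)) (frob 1 (a j) \<star> b i)" for i j
    using inverse_frob[OF less.prems(2), of 0 i] inverse_frob[OF less.prems(2), of 1 j]
    by (intro inverse_mod_times inverse_mod_sym[of _ "frob 1 (a j)"]) (simp_all add: frob_0[simplified])
  have "mcong (p ^ s) (a (Suc s) \<star> frob 1 (b s)) (a s \<star> frob 1 (b (s - 1)))"
    using less by (intro a_step_cong_aux) auto
  from inverse_mod_unique[OF inv inv this] show ?case .
qed

lemma a_step_cong:
  "1 \<le> s \<Longrightarrow> s \<le> N \<Longrightarrow> mcong (p ^ s) (a (Suc s) \<star> frob 1 (b s)) (a s \<star> frob 1 (b (s - 1)))"
  by (rule a_step_cong_aux, assumption+) (rule b_step_cong, simp_all)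

text \<open>Applying D after \<sigma>^m to the recursion gives terms \<open>?P\<close>, where D hits
  \<beta>_k, and \<open>?Q\<close>, where it hits \<sigma>^k(a_(s-k)). The former are settled by
  \<open>ratio_frob_cong\<close>. The latter contain logarithmic derivatives with index s-k and
  twist m+k, hence the induction on s for all m at once: the sum s+m, which is the precision, stays
  the same.\<close>

lemma log_derivative_cong:
  assumes D: "is_derivation D" and N: "s + m < N"
  shows "mcong (p ^ (s + m)) (mat_map D (frob m (a (Suc s))) \<star> frob m (b (Suc s)))
    (mat_map D (frob m (a s)) \<star> frob m (b s))"
  using N
proof (induction s arbitrary: m rule: less_induct)
  case (less s)
  let ?E = "\<lambda>m A. mat_map D (frob m A)"
  let ?P = "\<lambda>r k. ?E m (\<beta> k) \<star> frob (m + k) (a (r - k))"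
  let ?Q = "\<lambda>r k. frob m (\<beta> k) \<star> ?E (m + k) (a (r - k))"
  have E_dvd: "of_nat (p ^ n) dvd ?E n A u v" for n A u v
    unfolding mat_map_def by (rule dvd_derivation_frobenius_funpow[OF D frobenius p_pos])
  \<comment> \<open>The factor p^(k-1) of \<beta>_k passes through \<sigma>^m and D; the remaining
    p^m comes from applying D to values of \<sigma>^m.\<close>
  have E\<beta>_dvd: "of_nat (p ^ (k - 1 + m)) dvd ?E m (\<beta> k) u v" if k: "k \<ge> 1" and uv: "u \<in> J" "v \<in> J" for k u v
  proof -
    obtain y where y: "\<beta> k u v = of_nat (p ^ (k - 1)) * y"
      using \<beta>_dvd[of k u v] k uv by (auto simp: dvd_def)
    have "?E m (\<beta> k) u v = of_nat (p ^ (k - 1)) * D ((\<sigma> ^^ m) y)"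
      by (simp only: mat_map_def y ring_endo.map_mult[OF endo] ring_endo.map_of_nat[OF endo]
          derivation_of_nat_mult[OF D])
    then show ?thesis
      using dvd_derivation_frobenius_funpow[OF D frobenius p_pos, of m y]
      by (simp add: power_add mult_dvd_mono)
  qed
  have frob\<beta>_dvd: "of_nat (p ^ (k - 1)) dvd frob m (\<beta> k) u v" if "k \<ge> 1" "u \<in> J" "v \<in> J" for k u v
    unfolding mat_map_def using that by (intro ring_endo.of_nat_dvd_map[OF endo] \<beta>_dvd) auto
  have E_times: "?E m (A \<star> B) u v = (?E m A \<star> frob m B) u v + (frob m A \<star> ?E m B) u v" for A B u v
    by (simp add: mat_map_def mat_times_apply ring_endo.map_sum[OF endo] ring_endo.map_mult[OF endo]
        derivation_sum[OF D] derivation_mult[OF D] sum.distrib)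
  have E_rec: "?E m (a r) u v = (\<Sum>k\<in>{1..r}. ?P r k u v + ?Q r k u v)"
    if r: "r > 0" and u: "u \<in> J" and v: "v \<in> J" for r u v
  proof -
    have "?E m (a r) u v = (\<Sum>k\<in>{1..r}. ?E m (\<beta> k \<star> frob k (a (r - k))) u v)"
      unfolding mat_map_def a_rec[OF r u v]
      by (simp add: ring_endo.map_sum[OF endo] derivation_sum[OF D])
    then show ?thesis unfolding E_times frob_frob .
  qed
  have distrib: "(\<lambda>u v. \<Sum>k\<in>K. A k u v + A' k u v) \<star> C
      = (\<lambda>u v. \<Sum>k\<in>K. (A k \<star> C) u v + (A' k \<star> C) u v)" for K :: "nat set" and A A' C
    unfolding sum_mat_times by (simp add: mat_times_apply distrib_right sum.distrib)
  have E_a: "mcong n (?E m (a r) \<star> C) (\<lambda>u v. \<Sum>k\<in>{1..r}. (?P r k \<star> C) u v + (?Q r k \<star> C) u v)"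
    if "r > 0" for n r C
    unfolding distrib[symmetric] using that
    by (intro mcong_times) (simp_all add: mat_cong_base_ring E_rec)
  have ratio: "mcong (p ^ (Suc s - k)) (frob (m + k) (a (Suc s - k)) \<star> frob m (b (Suc s)))
      (frob (m + k) (a (s - k)) \<star> frob m (b s))" if "k \<le> s" for k
    using mcong_map[OF endo[of m] ratio_frob_cong[OF _ that b_step_cong]] less.prems
    unfolding mat_map_times[OF endo] frob_frob by simp
  have term1: "mcong (p ^ (s + m)) (?P (Suc s) k \<star> frob m (b (Suc s))) (?P s k \<star> frob m (b s))"
    if "1 \<le> k" "k \<le> s" for k
  proof -
    have "mcong (p ^ (k - 1 + m) * p ^ (Suc s - k)) (?P (Suc s) k \<star> frob m (b (Suc s))) (?P s k \<star> frob m (b s))"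
      unfolding mat_times_assoc using that by (intro mcong_times_scaled E\<beta>_dvd ratio) auto
    moreover have "k - 1 + m + (Suc s - k) = s + m" using that by auto
    ultimately show ?thesis by (simp only: power_add[symmetric])
  qed
  have term2: "mcong (p ^ (s + m)) (?Q (Suc s) k \<star> frob m (b (Suc s))) (?Q s k \<star> frob m (b s))"
    if k: "1 \<le> k" "k \<le> s" for k
  proof -
    \<comment> \<open>Inserting an inverse pair writes the derivative as a logarithmic derivative
      times a matrix, so that the induction hypothesis applies.\<close>
    have expand: "mcong (p ^ (s + m)) (?E (m + k) (a i) \<star> C)
        (?E (m + k) (a i) \<star> frob (m + k) (b i) \<star> (frob (m + k) (a i) \<star> C))" for i C
    proof -
      have "s + m \<le> N" using less.prems by simp
      from mcong_sym[OF mcong_times[OF mcong_cancel_right[OF inverse_mod_sym[OF inverse_frob[OF this]]] mcong_refl]]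
      show ?thesis unfolding mat_times_assoc .
    qed
    let ?T = "\<lambda>i. ?E (m + k) (a i) \<star> frob (m + k) (b i)"
    have "mcong (p ^ (s - k + (m + k))) (?T (Suc (s - k))) (?T (s - k))"
      by (rule less.IH) (use k less.prems in auto)
    then have IH: "mcong (p ^ (s + m)) (?T (Suc s - k)) (?T (s - k))"
      using k by (simp add: Suc_diff_le add.commute)
    have "mcong (p ^ (s + m)) (?E (m + k) (a (Suc s - k)) \<star> frob m (b (Suc s)))
        (?T (Suc s - k) \<star> (frob (m + k) (a (Suc s - k)) \<star> frob m (b (Suc s))))"
      by (rule expand)
    also have "mcong (p ^ (s + m)) \<dots> (?T (s - k) \<star> (frob (m + k) (a (Suc s - k)) \<star> frob m (b (Suc s))))"
      by (rule mcong_times[OF IH mcong_refl])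
    also have "mcong (p ^ (s + m)) \<dots> (?T (s - k) \<star> (frob (m + k) (a (s - k)) \<star> frob m (b s)))"
    proof -
      \<comment> \<open>The ratios agree only modulo p^(s+1-k), but the logarithmic derivative on
        their left is divisible by p^(m+k); together this gives even p^(s+m+1).\<close>
      have "mcong (p ^ (m + k) * p ^ (Suc s - k))
          (?T (s - k) \<star> (frob (m + k) (a (Suc s - k)) \<star> frob m (b (Suc s))))
          (?T (s - k) \<star> (frob (m + k) (a (s - k)) \<star> frob m (b s)))"
        unfolding mat_times_apply[of "?E _ _"]
        by (intro mcong_times_scaled ratio k(2) dvd_sum dvd_mult2 E_dvd)
      moreover have "p ^ (s + m) dvd p ^ (m + k) * p ^ (Suc s - k)"
        unfolding power_add[symmetric] using k by (intro le_imp_power_dvd) auto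
      ultimately show ?thesis by (rule mcong_mono)
    qed
    also have "mcong (p ^ (s + m)) \<dots> (?E (m + k) (a (s - k)) \<star> frob m (b s))"
      by (rule mcong_sym[OF expand])
    finally show ?thesis unfolding mat_times_assoc by (rule mcong_times[OF mcong_refl])
  qed
  have last1: "mcong (p ^ (s + m)) (?P (Suc s) (Suc s) \<star> C) (\<lambda>u v. 0)" for C
    unfolding mat_times_assoc by (intro mcong_zero_times) (use E\<beta>_dvd[of "Suc s"] in simp)
  \<comment> \<open>The matrix a_0 is the identity, whose derivative vanishes; this removes the
    \<open>?Q\<close> term with k = s+1.\<close>
  have E_a_0: "?E n (a 0) = (\<lambda>u v. 0)" for n
    by (simp add: a_0 mat_map_one[OF endo] fun_eq_iff)
      (simp add: mat_map_def mat_one_base_ring derivation_one[OF D] derivation_zero[OF D])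
  have last2: "?Q (Suc s) (Suc s) \<star> C = (\<lambda>u v. 0)" for C
    unfolding diff_self_eq_0 E_a_0 by (simp add: fun_eq_iff mat_times_apply)
  have "mcong (p ^ (s + m)) (?E m (a (Suc s)) \<star> frob m (b (Suc s)))
      (\<lambda>u v. \<Sum>k\<in>{1..Suc s}. (?P (Suc s) k \<star> frob m (b (Suc s))) u v + (?Q (Suc s) k \<star> frob m (b (Suc s))) u v)"
    by (rule E_a) simp
  also have "mcong (p ^ (s + m)) \<dots>
      (\<lambda>u v. \<Sum>k\<in>{1..s}. (?P (Suc s) k \<star> frob m (b (Suc s))) u v + (?Q (Suc s) k \<star> frob m (b (Suc s))) u v)"
    using last1 unfolding mat_cong_base_ring by (simp add: last2[unfolded diff_self_eq_0] del: funpow.simps add_Suc_right)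
  also have "mcong (p ^ (s + m)) \<dots>
      (\<lambda>u v. \<Sum>k\<in>{1..s}. (?P s k \<star> frob m (b s)) u v + (?Q s k \<star> frob m (b s)) u v)"
    unfolding sum.distrib using mcong_sum[of "{1..s}", OF term1] mcong_sum[of "{1..s}", OF term2]
    unfolding mat_cong_base_ring by (auto simp: add_diff_add intro!: dvd_add)
  also have "mcong (p ^ (s + m)) \<dots> (?E m (a s) \<star> frob m (b s))"
  proof (cases "s > 0")
    case True
    then show ?thesis by (intro mcong_sym[OF E_a])
  next
    case False
    then show ?thesis by (simp add: E_a_0 mat_times_apply mat_cong_base_ring)
  qed
  finally show ?case .
qed

end


subsection \<open>Congruences between prime powers\<close>

lemma freshmans_dream_dvd:
  fixes x y :: "'a::comm_ring_1"
  assumes "Factorial_Ring.prime p"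
  shows "of_nat p dvd (x + y) ^ p - (x ^ p + y ^ p)"
proof -
  have p: "p > 0" using assms prime_gt_0_nat by simp
  let ?t = "\<lambda>k. of_nat (p choose k) * x ^ k * y ^ (p - k)"
  have "(x + y) ^ p = (\<Sum>k\<in>{..p}. ?t k)" by (rule binomial_ring)
  also have "{..p} = {0, p} \<union> {0<..<p}" using p by auto
  also have "(\<Sum>k\<in>{0, p} \<union> {0<..<p}. ?t k) = (\<Sum>k\<in>{0, p}. ?t k) + (\<Sum>k\<in>{0<..<p}. ?t k)"
    by (rule sum.union_disjoint) auto
  also have "(\<Sum>k\<in>{0, p}. ?t k) = x ^ p + y ^ p" using p by (simp add: add.commute)
  finally have "(x + y) ^ p - (x ^ p + y ^ p) = (\<Sum>k\<in>{0<..<p}. ?t k)" by simp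
  also have "of_nat p dvd \<dots>"
    by (intro dvd_sum dvd_mult2 of_nat_dvd_mono dvd_choose_prime) (use assms in auto)
  finally show ?thesis .
qed

lemma diff_dvd_power_diff: "x - y dvd x ^ n - y ^ n" for x y :: "'a::comm_ring_1"
  by (simp add: power_diff_sumr2)

lemma freshmans_dream_power_dvd:
  fixes x y :: "'a::comm_ring_1"
  assumes "Factorial_Ring.prime p"
  shows "of_nat p dvd (x + y) ^ (p ^ k) - (x ^ (p ^ k) + y ^ (p ^ k))"
proof (induction k)
  case (Suc k)
  let ?x = "x ^ (p ^ k)" and ?y = "y ^ (p ^ k)"
  have "of_nat p dvd ((x + y) ^ (p ^ k)) ^ p - (?x + ?y) ^ p"
    by (rule dvd_trans[OF Suc.IH diff_dvd_power_diff])
  from dvd_add[OF this freshmans_dream_dvd[OF assms, of ?x ?y]] show ?case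
    unfolding power_Suc2[of p k] power_mult by (simp add: algebra_simps)
qed simp

lemma sum_power_prime_power_dvd:
  fixes g :: "'b \<Rightarrow> 'a::comm_ring_1"
  assumes p: "Factorial_Ring.prime p" and K: "finite K"
  shows "of_nat p dvd (sum g K) ^ (p ^ k) - (\<Sum>e\<in>K. g e ^ (p ^ k))"
  using K
proof (induction K rule: finite_induct)
  case empty
  \<comment> \<open>For the empty sum the exponent must be positive, since 0^0 = 1.\<close>
  have "p ^ k > 0" using p prime_gt_0_nat by simp
  then show ?case by (simp add: power_0_left)
next
  case (insert e K)
  then show ?case
    using dvd_add[OF freshmans_dream_power_dvd[OF p, of "g e" "sum g K" k] insert.IH]
    by (simp add: algebra_simps)
qed

text \<open>In x^p - y^p = (x - y) S one has x \<equiv> y modulo p, so S \<equiv> p y^(p-1) \<equiv>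
  0 modulo p. The exponent \<open>Suc n\<close> guarantees the congruence modulo p.\<close>

lemma dvd_power_prime_diff:
  fixes x y :: "'a::comm_ring_1"
  assumes "of_nat (p ^ Suc n) dvd x - y"
  shows "of_nat (p ^ Suc (Suc n)) dvd x ^ p - y ^ p"
proof -
  have p: "of_nat p dvd x - y"
    using assms by (rule dvd_trans[OF of_nat_dvd_mono, rotated]) simp
  have "(\<Sum>i<p. y ^ (p - Suc i) * x ^ i) = (\<Sum>i<p. y ^ (p - Suc i) * (x ^ i - y ^ i)) + (\<Sum>i<p. y ^ (p - Suc i) * y ^ i)"
    by (simp add: algebra_simps flip: sum.distrib)
  also have "(\<Sum>i<p. y ^ (p - Suc i) * y ^ i) = of_nat p * y ^ (p - 1)"
    by (simp flip: power_add)
  also have "of_nat p dvd (\<Sum>i<p. y ^ (p - Suc i) * (x ^ i - y ^ i)) + of_nat p * y ^ (p - 1)"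
    by (intro dvd_add[OF dvd_sum dvd_triv_left] dvd_mult dvd_trans[OF p diff_dvd_power_diff])
  finally have "of_nat (p ^ Suc n) * of_nat p dvd (x - y) * (\<Sum>i<p. y ^ (p - Suc i) * x ^ i)"
    by (intro mult_dvd_mono assms)
  then show ?thesis by (simp add: power_diff_sumr2 mult.commute mult.left_commute)
qed

lemma dvd_power_prime_power_diff:
  fixes x y :: "'a::comm_ring_1"
  assumes "of_nat p dvd x - y"
  shows "of_nat (p ^ Suc n) dvd x ^ (p ^ n) - y ^ (p ^ n)"
proof (induction n)
  case 0
  then show ?case using assms by simp
next
  case (Suc n)
  from dvd_power_prime_diff[OF this] show ?case
    by (simp only: power_Suc2[of p n] power_mult)
qed

lemma frobenius_funpow_dvd:
  assumes "frobenius_endo p \<sigma>"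
  shows "of_nat p dvd (\<sigma> ^^ k) c - c ^ (p ^ k)"
proof (induction k)
  case (Suc k)
  interpret ring_endo \<sigma> by (rule frobenius_endo_ring_endo[OF assms])
  have "of_nat p dvd \<sigma> ((\<sigma> ^^ k) c) - \<sigma> (c ^ (p ^ k))"
    using of_nat_dvd_map[OF Suc.IH] by (simp add: map_diff)
  from dvd_add[OF this frobenius_endo_dvd[OF assms, of "c ^ (p ^ k)"]] show ?case
    by (simp add: mult.commute[of p] flip: power_mult)
qed simp


subsection \<open>Frobenius lifts on Laurent polynomials\<close>

text \<open>With q = p^k and \<tau> = \<sigma>^k this is the map \<phi>_k.\<close>

definition laurent_frob ::
  "nat \<Rightarrow> ('r \<Rightarrow> 'r) \<Rightarrow> ('r::comm_ring_1, 'n::finite) laurent \<Rightarrow> ('r, 'n) laurent" where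
  "laurent_frob q \<tau> P = (\<Sum>e\<in>Poly_Mapping.keys P.
     Poly_Mapping.single (int q *s e) (\<tau> (Poly_Mapping.lookup P e)))"

lemma poly_mapping_sum_single:
  "P = (\<Sum>e\<in>Poly_Mapping.keys P. Poly_Mapping.single e (Poly_Mapping.lookup P e))"
  by (rule poly_mapping_eqI)
    (auto simp: lookup_sum lookup_single when_def sum.delta in_keys_iff)

lemma single_of_nat_mult:
  "Poly_Mapping.single e (of_nat n * c) = of_nat n * Poly_Mapping.single e (c :: 'r::comm_ring_1)"
  for e :: "int ^ 'n::finite"
  using mult_single[of 0 "of_nat n" e c] by simp

lemma lookup_of_nat_mult:
  "Poly_Mapping.lookup (of_nat n * P) e = of_nat n * Poly_Mapping.lookup P e"
  for P :: "('r::comm_ring_1, 'n::finite) laurent"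
  by (induction n) (simp_all add: algebra_simps lookup_add)

lemma of_nat_dvd_lookup:
  "of_nat n dvd P \<Longrightarrow> of_nat n dvd Poly_Mapping.lookup P e"
  for P :: "('r::comm_ring_1, 'n::finite) laurent"
  by (auto simp: dvd_def lookup_of_nat_mult)

lemma single_power:
  "Poly_Mapping.single e c ^ n = Poly_Mapping.single (int n *s e) (c ^ n)"
  for e :: "int ^ 'n::finite" and c :: "'r::comm_ring_1"
  by (induction n) (simp_all add: mult_single vector_sadd_rdistrib)

lemma lookup_mult_single:
  "Poly_Mapping.lookup (P * Poly_Mapping.single e c) x = Poly_Mapping.lookup P (x - e) * c"
  for P :: "('r::comm_ring_1, 'n::finite) laurent"
proof -
  have "P * Poly_Mapping.single e c
    = (\<Sum>d\<in>Poly_Mapping.keys P. Poly_Mapping.single (d + e) (Poly_Mapping.lookup P d * c))"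
    using arg_cong[OF poly_mapping_sum_single[of P], of "\<lambda>P. P * Poly_Mapping.single e c"]
    by (simp only: sum_distrib_right mult_single)
  moreover have "d + e = x \<longleftrightarrow> x - e = d" for d by auto
  ultimately show ?thesis
    by (simp add: lookup_sum lookup_single when_def sum.delta' in_keys_iff)
qed

context ring_endo
begin

text \<open>Lets the supports of P, Q and P + Q be replaced by one common index set, although
  cancellation may shrink the last.\<close>

lemma laurent_frob_superset:
  "finite K \<Longrightarrow> Poly_Mapping.keys P \<subseteq> K \<Longrightarrow>
   laurent_frob q \<tau> P = (\<Sum>e\<in>K. Poly_Mapping.single (int q *s e) (\<tau> (Poly_Mapping.lookup P e)))"
  unfolding laurent_frob_def
  by (rule sum.mono_neutral_left) (auto simp: in_keys_iff map_zero)

lemma laurent_frob_add: "laurent_frob q \<tau> (P + Q) = laurent_frob q \<tau> P + laurent_frob q \<tau> Q"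
proof -
  let ?K = "Poly_Mapping.keys P \<union> Poly_Mapping.keys Q"
  show ?thesis
    using laurent_frob_superset[of ?K P q] laurent_frob_superset[of ?K Q q]
      laurent_frob_superset[of ?K "P + Q" q] keys_add[of P Q]
    by (simp add: lookup_add map_add single_add sum.distrib)
qed

lemma laurent_frob_single:
  "laurent_frob q \<tau> (Poly_Mapping.single e c) = Poly_Mapping.single (int q *s e) (\<tau> c)"
  by (cases "c = 0") (simp_all add: laurent_frob_def map_zero)

lemma laurent_frob_sum: "laurent_frob q \<tau> (sum g K) = (\<Sum>e\<in>K. laurent_frob q \<tau> (g e))"
  by (induction K rule: infinite_finite_induct) (simp_all add: laurent_frob_add, simp_all add: laurent_frob_def)

lemma laurent_frob_one: "laurent_frob q \<tau> 1 = 1"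
  using laurent_frob_single[of q 0 1] by (simp add: map_one)

lemma laurent_frob_mult: "laurent_frob q \<tau> (P * Q) = laurent_frob q \<tau> P * laurent_frob q \<tau> Q"
proof -
  have "P * Q = (\<Sum>d\<in>Poly_Mapping.keys P. \<Sum>e\<in>Poly_Mapping.keys Q.
      Poly_Mapping.single (d + e) (Poly_Mapping.lookup P d * Poly_Mapping.lookup Q e))"
    using arg_cong2[OF poly_mapping_sum_single[of P] poly_mapping_sum_single[of Q], of times]
    by (simp only: sum_product mult_single)
  then show ?thesis
    by (simp add: laurent_frob_sum laurent_frob_single)
      (simp add: laurent_frob_def sum_product mult_single vector_add_ldistrib map_mult)
qed

lemma laurent_frob_power: "laurent_frob q \<tau> (P ^ n) = laurent_frob q \<tau> P ^ n"
  by (induction n) (simp_all add: laurent_frob_one laurent_frob_mult)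

end

text \<open>Both terms are congruent modulo p to the sum of the p^k-th powers of the monomials of h:
  the first because \<sigma>^k(c) \<equiv> c^(p^k), the second by the binomial theorem.\<close>

lemma laurent_frob_dvd:
  fixes h :: "('r::comm_ring_1, 'n::finite) laurent"
  assumes p: "Factorial_Ring.prime p" and \<sigma>: "frobenius_endo p \<sigma>"
  shows "of_nat p dvd laurent_frob (p ^ k) (\<sigma> ^^ k) h - h ^ (p ^ k)"
proof -
  let ?g = "\<lambda>e. Poly_Mapping.single e (Poly_Mapping.lookup h e)"
  have "of_nat p dvd Poly_Mapping.single (int (p ^ k) *s e) ((\<sigma> ^^ k) c) - Poly_Mapping.single e c ^ (p ^ k)"
    for e :: "int ^ 'n" and c
  proof -
    obtain d where "(\<sigma> ^^ k) c - c ^ (p ^ k) = of_nat p * d"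
      using frobenius_funpow_dvd[OF \<sigma>, of k c] by (auto simp: dvd_def)
    then show ?thesis
      by (simp add: single_power single_of_nat_mult flip: single_diff)
  qed
  then have "of_nat p dvd laurent_frob (p ^ k) (\<sigma> ^^ k) h - (\<Sum>e\<in>Poly_Mapping.keys h. ?g e ^ (p ^ k))"
    unfolding laurent_frob_def sum_subtractf[symmetric] by (intro dvd_sum) blast
  moreover have "of_nat p dvd h ^ (p ^ k) - (\<Sum>e\<in>Poly_Mapping.keys h. ?g e ^ (p ^ k))"
    using sum_power_prime_power_dvd[OF p finite_keys[of h], of ?g k]
    by (simp only: poly_mapping_sum_single[symmetric])
  ultimately have "of_nat p dvd laurent_frob (p ^ k) (\<sigma> ^^ k) h - (\<Sum>e\<in>Poly_Mapping.keys h. ?g e ^ (p ^ k))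
      - (h ^ (p ^ k) - (\<Sum>e\<in>Poly_Mapping.keys h. ?g e ^ (p ^ k)))"
    by (rule dvd_diff)
  then show ?thesis by simp
qed


subsection \<open>Decomposition of the powers of a Laurent polynomial\<close>

text \<open>These are the polynomials I_s: the decomposition of F_s is solved for its term k = s,
  whose second factor \<phi>_s(F_0) is 1.\<close>

fun power_part ::
  "nat \<Rightarrow> ('r \<Rightarrow> 'r) \<Rightarrow> ('r::comm_ring_1, 'n::finite) laurent \<Rightarrow> nat \<Rightarrow> ('r, 'n) laurent" where
  "power_part p \<sigma> f s = f ^ (p ^ s - 1)
     - (\<Sum>k\<in>{1..<s}. power_part p \<sigma> f k * laurent_frob (p ^ k) (\<sigma> ^^ k) (f ^ (p ^ (s - k) - 1)))"

declare power_part.simps [simp del]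

lemma power_decomposition:
  assumes "frobenius_endo p \<sigma>" "s > 0"
  shows "f ^ (p ^ s - 1)
    = (\<Sum>k\<in>{1..s}. power_part p \<sigma> f k * laurent_frob (p ^ k) (\<sigma> ^^ k) (f ^ (p ^ (s - k) - 1)))"
proof -
  have "{1..s} = insert s {1..<s}" using assms(2) by auto
  then show ?thesis
    by (simp add: power_part.simps[of p \<sigma> f s]
        ring_endo.laurent_frob_one[OF ring_endo_funpow[OF frobenius_endo_ring_endo[OF assms(1)]]])
qed

text \<open>From F_(n+1) = F_n h^(p^n), used for F_s and inside every \<phi>_k(F_(s-k)), I_s becomes
  the sum over k < s of I_k \<phi>_k(F_(s-1-k)) (h^(p^(s-1)) - \<phi>_k(h)^(p^(s-1-k))). The
  difference is divisible by p^(s-k), and I_k by p^(k-1) by induction.\<close>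

lemma power_part_dvd:
  fixes f :: "('r::comm_ring_1, 'n::finite) laurent"
  assumes p: "Factorial_Ring.prime p" and \<sigma>: "frobenius_endo p \<sigma>" and s: "s > 0"
  shows "of_nat (p ^ (s - 1)) dvd power_part p \<sigma> f s"
  using s
proof (induction s rule: less_induct)
  case (less s)
  have p0: "p > 0" using p prime_gt_0_nat by simp
  define F where "F = (\<lambda>n. f ^ (p ^ n - 1))"
  define h where "h = f ^ (p - 1)"
  let ?\<phi> = "\<lambda>k. laurent_frob (p ^ k) (\<sigma> ^^ k) :: ('r, 'n) laurent \<Rightarrow> _"
  have F_Suc: "F (Suc n) = F n * h ^ (p ^ n)" for n
  proof -
    have "p ^ n \<ge> 1" "p * p ^ n \<ge> p ^ n" using p0 by simp_all
    then have "p ^ Suc n - 1 = (p ^ n - 1) + (p - 1) * p ^ n"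
      by (simp add: diff_mult_distrib)
    then show ?thesis unfolding F_def h_def by (simp add: power_add power_mult)
  qed
  show ?case
  proof (cases "s = 1")
    case False
    with less.prems have s: "Suc (s - 1) = s" "s - 1 > 0" by auto
    have "F s = F (s - 1) * h ^ (p ^ (s - 1))" using F_Suc[of "s - 1"] s by simp
    also have "F (s - 1) = (\<Sum>k\<in>{1..s - 1}. power_part p \<sigma> f k * ?\<phi> k (F (s - 1 - k)))"
      unfolding F_def by (rule power_decomposition[OF \<sigma> s(2)])
    also have "{1..s - 1} = {1..<s}" using s by auto
    finally have "power_part p \<sigma> f s = (\<Sum>k\<in>{1..<s}. power_part p \<sigma> f k * ?\<phi> k (F (s - 1 - k))) * h ^ (p ^ (s - 1))
        - (\<Sum>k\<in>{1..<s}. power_part p \<sigma> f k * ?\<phi> k (F (s - k)))"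
      by (simp add: power_part.simps[of p \<sigma> f s] F_def)
    also have "\<dots> = (\<Sum>k\<in>{1..<s}. power_part p \<sigma> f k *
        (?\<phi> k (F (s - 1 - k)) * (h ^ (p ^ (s - 1)) - ?\<phi> k h ^ (p ^ (s - 1 - k)))))"
      unfolding sum_distrib_right sum_subtractf[symmetric]
    proof (rule sum.cong[OF refl])
      fix k assume k: "k \<in> {1..<s}"
      interpret ring_endo "\<sigma> ^^ k"
        by (intro ring_endo_funpow frobenius_endo_ring_endo[OF \<sigma>])
      have "s - k = Suc (s - 1 - k)" using k by auto
      then have "F (s - k) = F (s - 1 - k) * h ^ (p ^ (s - 1 - k))" using F_Suc by simp
      then have "?\<phi> k (F (s - k)) = ?\<phi> k (F (s - 1 - k)) * ?\<phi> k h ^ (p ^ (s - 1 - k))"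
        by (simp add: laurent_frob_mult laurent_frob_power)
      then show "power_part p \<sigma> f k * ?\<phi> k (F (s - 1 - k)) * h ^ (p ^ (s - 1)) - power_part p \<sigma> f k * ?\<phi> k (F (s - k)) =
         power_part p \<sigma> f k * (?\<phi> k (F (s - 1 - k)) * (h ^ (p ^ (s - 1)) - ?\<phi> k h ^ (p ^ (s - 1 - k))))"
        by (simp add: algebra_simps)
    qed
    also have "of_nat (p ^ (s - 1)) dvd \<dots>"
    proof (intro dvd_sum)
      fix k assume k: "k \<in> {1..<s}"
      have "of_nat p dvd h ^ (p ^ k) - ?\<phi> k h"
        using laurent_frob_dvd[OF p \<sigma>, of k h] by (metis dvd_minus_iff minus_diff_eq)
      \<comment> \<open>Raising h^(p^k) \<equiv> \<phi>_k(h) to the power p^(s-1-k) turns the left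
        side into h^(p^(s-1)) and the modulus into p^(s-k).\<close>
      moreover have "Suc (s - 1 - k) = s - k" "k + (s - 1 - k) = s - 1" using k by auto
      ultimately have "of_nat (p ^ (s - k)) dvd h ^ (p ^ (s - 1)) - ?\<phi> k h ^ (p ^ (s - 1 - k))"
        using dvd_power_prime_power_diff[of p "h ^ (p ^ k)" "?\<phi> k h" "s - 1 - k"]
        by (simp only: power_mult[symmetric] power_add[symmetric])
      moreover have "of_nat (p ^ (k - 1)) dvd power_part p \<sigma> f k"
        using k by (intro less.IH) auto
      ultimately have "of_nat (p ^ (k - 1)) * of_nat (p ^ (s - k)) dvd power_part p \<sigma> f k *
        (?\<phi> k (F (s - 1 - k)) * (h ^ (p ^ (s - 1)) - ?\<phi> k h ^ (p ^ (s - 1 - k))))"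
        by (intro mult_dvd_mono dvd_mult)
      moreover have "k - 1 + (s - k) = s - 1" using k by auto
      ultimately show "of_nat (p ^ (s - 1)) dvd power_part p \<sigma> f k *
        (?\<phi> k (F (s - 1 - k)) * (h ^ (p ^ (s - 1)) - ?\<phi> k h ^ (p ^ (s - 1 - k))))"
        by (simp only: of_nat_mult[symmetric] power_add[symmetric])
    qed
    finally show ?thesis .
  qed simp
qed


subsection \<open>Supports and the recursion for higher Hasse--Witt matrices\<close>

text \<open>The exponents of P lie in the dilate of \<Delta> by c; for c = 0 and nonempty \<Delta>
  this is the origin.\<close>

definition supported_in :: "(real ^ 'n) set \<Rightarrow> nat \<Rightarrow> ('r::zero, 'n::finite) laurent \<Rightarrow> bool" where
  "supported_in \<Delta> c P \<longleftrightarrow> (\<forall>e\<in>Poly_Mapping.keys P. \<exists>x\<in>\<Delta>. real_point e = real c *\<^sub>R x)"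

lemma real_point_add: "real_point (d + e) = real_point d + real_point e"
  and real_point_diff: "real_point (d - e) = real_point d - real_point e"
  and real_point_scale: "real_point (int n *s d) = real n *\<^sub>R real_point d"
  and real_point_zero: "real_point 0 = 0"
  by (simp_all add: real_point_def vec_eq_iff)

lemma supported_in_mult:
  fixes P Q :: "('r::comm_ring_1, 'n::finite) laurent"
  assumes "convex \<Delta>" "supported_in \<Delta> c P" "supported_in \<Delta> d Q"
  shows "supported_in \<Delta> (c + d) (P * Q)"
  unfolding supported_in_def
proof
  fix e assume "e \<in> Poly_Mapping.keys (P * Q)"
  then obtain i j where e: "e = i + j" and "i \<in> Poly_Mapping.keys P" "j \<in> Poly_Mapping.keys Q"
    using keys_mult[of P Q] by blast
  with assms obtain x y where x: "x \<in> \<Delta>" "real_point i = real c *\<^sub>R x"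
    and y: "y \<in> \<Delta>" "real_point j = real d *\<^sub>R y"
    unfolding supported_in_def by blast
  show "\<exists>x\<in>\<Delta>. real_point e = real (c + d) *\<^sub>R x"
  \<comment> \<open>The convex weights c/(c+d) and d/(c+d) need a nonzero denominator; otherwise the
    exponent is 0 and any point of \<Delta> serves.\<close>
  proof (cases "c + d = 0")
    case True
    then show ?thesis using x y by (auto simp: e real_point_add)
  next
    case False
    let ?z = "(c / (c + d)) *\<^sub>R x + (d / (c + d)) *\<^sub>R y"
    have nz: "real c + real d \<noteq> 0" using False by (metis of_nat_add of_nat_eq_0_iff)
    then have "?z \<in> \<Delta>"
      by (intro convexD[OF assms(1)] x y) (simp_all add: add_divide_distrib[symmetric])
    moreover have "real_point e = real (c + d) *\<^sub>R ?z"
      using nz by (simp add: e real_point_add x y scaleR_add_right)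
    ultimately show ?thesis by blast
  qed
qed

lemma supported_in_diff:
  "supported_in \<Delta> c P \<Longrightarrow> supported_in \<Delta> c Q \<Longrightarrow> supported_in \<Delta> c (P - Q)"
  for P Q :: "('r::comm_ring_1, 'n::finite) laurent"
  using keys_diff[of P Q] unfolding supported_in_def by blast

lemma supported_in_sum:
  "(\<And>k. k \<in> K \<Longrightarrow> supported_in \<Delta> c (P k)) \<Longrightarrow> supported_in \<Delta> c (\<Sum>k\<in>K. P k)"
  for P :: "_ \<Rightarrow> ('r::comm_ring_1, 'n::finite) laurent"
  using keys_sum[of P K] unfolding supported_in_def by blast

lemma supported_in_laurent_frob:
  assumes "supported_in \<Delta> c P"
  shows "supported_in \<Delta> (q * c) (laurent_frob q \<tau> P)"
  unfolding laurent_frob_def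
proof (rule supported_in_sum)
  fix e assume "e \<in> Poly_Mapping.keys P"
  with assms obtain x where "x \<in> \<Delta>" "real_point e = real c *\<^sub>R x"
    unfolding supported_in_def by blast
  then show "supported_in \<Delta> (q * c) (Poly_Mapping.single (int q *s e) (\<tau> (Poly_Mapping.lookup P e)))"
    by (auto simp: supported_in_def real_point_scale split: if_splits)
qed

lemma supported_in_power:
  fixes f :: "('r::comm_ring_1, 'n::finite) laurent"
  assumes "newton_polytope f \<noteq> {}"
  shows "supported_in (newton_polytope f) n (f ^ n)"
proof (induction n)
  \<comment> \<open>The exponent 0 must be 0 times some point of \<Delta>, so nonemptiness enters
    here.\<close>
  case 0
  then show ?case using assms by (auto simp: supported_in_def real_point_zero)
next
  case (Suc n)
  have "supported_in (newton_polytope f) 1 f"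
    by (auto simp: supported_in_def newton_polytope_def intro: hull_inc)
  from supported_in_mult[OF _ this Suc] show ?case
    by (simp add: newton_polytope_def convex_convex_hull)
qed

lemma supported_in_power_part:
  fixes f :: "('r::comm_ring_1, 'n::finite) laurent"
  assumes "newton_polytope f \<noteq> {}" "p > 0"
  shows "supported_in (newton_polytope f) (p ^ s - 1) (power_part p \<sigma> f s)"
proof (induction s rule: less_induct)
  case (less s)
  have "supported_in (newton_polytope f) (p ^ s - 1)
      (power_part p \<sigma> f k * laurent_frob (p ^ k) (\<sigma> ^^ k) (f ^ (p ^ (s - k) - 1)))"
    if k: "k \<in> {1..<s}" for k
  proof -
    have "p ^ k * p ^ (s - k) = p ^ s" using k by (simp flip: power_add)
    moreover have "p ^ k \<ge> 1" "p ^ s \<ge> p ^ k" using k assms(2) by (auto intro: power_increasing)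
    \<comment> \<open>The dilation factors of I_k and of \<phi>_k(F_(s-k)) add up to that of
      F_s.\<close>
    ultimately have "p ^ k - 1 + p ^ k * (p ^ (s - k) - 1) = p ^ s - 1"
      by (simp add: diff_mult_distrib2)
    then show ?thesis
      using supported_in_mult[OF _ less.IH supported_in_laurent_frob[OF supported_in_power[OF assms(1)]], of k] k
      by (metis atLeastLessThan_iff convex_convex_hull newton_polytope_def)
  qed
  then show ?case
    unfolding power_part.simps[of p \<sigma> f s]
    by (intro supported_in_diff supported_in_sum supported_in_power assms(1))
qed

text \<open>If \<open>u\<close> is interior to \<open>\<Delta>\<close> and \<open>q w - u\<close> lies in \<open>(q - 1) \<Delta>\<close>, then \<open>w\<close> is a convex combination
  of \<open>u\<close> and a point of \<open>\<Delta>\<close> with positive weight on \<open>u\<close>, hence interior. This is why the sum in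
  the product below only runs over interior points.\<close>

lemma interior_points_shrink:
  fixes f :: "('r::comm_ring_1, 'n::finite) laurent"
  assumes "supported_in (newton_polytope f) (q - 1) P" "q > 0" "u \<in> interior_points f"
    and "Poly_Mapping.lookup P (int q *s w - u) \<noteq> 0"
  shows "w \<in> interior_points f"
proof -
  have "int q *s w - u \<in> Poly_Mapping.keys P" using assms(4) by (simp only: in_keys_iff not_False_eq_True)
  with assms(1) obtain x where x: "x \<in> newton_polytope f" "real_point (int q *s w - u) = real (q - 1) *\<^sub>R x"
    unfolding supported_in_def by blast
  have "real q *\<^sub>R real_point w = real q *\<^sub>R (x - (1 / real q) *\<^sub>R (x - real_point u))"
    using x(2) assms(2)
    by (simp add: real_point_diff real_point_scale of_nat_diff algebra_simps)
  then have "real_point w = x - (1 / real q) *\<^sub>R (x - real_point u)"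
    using assms(2) by simp
  also have "\<dots> \<in> interior (newton_polytope f)"
    by (rule mem_interior_convex_shrink)
      (use assms(2,3) x in \<open>auto simp: interior_points_def newton_polytope_def convex_convex_hull\<close>)
  finally show ?thesis by (simp add: interior_points_def)
qed

text \<open>Coefficient extraction becomes a matrix product: a monomial e of Q contributes the
  coefficient of P at q(z-e) - u, and w = z-e is the summation index.\<close>

lemma lookup_mult_laurent_frob:
  fixes f P Q :: "('r::comm_ring_1, 'n::finite) laurent"
  assumes \<tau>: "ring_endo \<tau>" and P: "supported_in (newton_polytope f) (q - 1) P"
    and q: "q > 0" and u: "u \<in> interior_points f"
  shows "Poly_Mapping.lookup (P * laurent_frob q \<tau> Q) (int q *s z - u)
    = (\<Sum>w\<in>interior_points f. Poly_Mapping.lookup P (int q *s w - u) * \<tau> (Poly_Mapping.lookup Q (z - w)))"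
proof -
  let ?J = "interior_points f"
  let ?K = "(\<lambda>e. z - e) ` Poly_Mapping.keys Q"
  let ?g = "\<lambda>w. Poly_Mapping.lookup P (int q *s w - u) * \<tau> (Poly_Mapping.lookup Q (z - w))"
  have "Poly_Mapping.lookup (P * laurent_frob q \<tau> Q) (int q *s z - u)
    = (\<Sum>e\<in>Poly_Mapping.keys Q. Poly_Mapping.lookup P (int q *s z - u - int q *s e) * \<tau> (Poly_Mapping.lookup Q e))"
    by (simp add: laurent_frob_def sum_distrib_left lookup_sum lookup_mult_single)
  also have "\<dots> = sum ?g ?K"
    by (subst sum.reindex) (auto intro!: inj_onI simp: algebra_simps vector_ssub_ldistrib)
  also have "\<dots> = sum ?g ?J"
  \<comment> \<open>Interior points outside the image of the support have zero coefficient in Q;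
    points of the image that are not interior have zero coefficient in P by
    \<open>interior_points_shrink\<close>.\<close>
  proof (rule sum.mono_neutral_cong)
    show "?g w = 0" if "w \<in> ?J - ?K" for w
    proof -
      have "z - w \<notin> Poly_Mapping.keys Q" using that by (auto simp: image_iff algebra_simps)
      then show ?thesis by (simp add: in_keys_iff ring_endo.map_zero[OF \<tau>])
    qed
    show "?g w = 0" if "w \<in> ?K - ?J" for w
    proof -
      have "Poly_Mapping.lookup P (int q *s w - u) = 0"
        using interior_points_shrink[OF P q u, of w] that by blast
      then show ?thesis by (simp only: mult_zero_left)
    qed
  qed (simp_all add: finite_interior_points)
  finally show ?thesis .
qed

lemma hasse_witt_decomposition:
  fixes f :: "('r::comm_ring_1, 'n::finite) laurent"
  assumes \<sigma>: "frobenius_endo p \<sigma>" and p: "p > 0" and s: "s > 0" and u: "u \<in> interior_points f"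
  shows "hasse_witt p f s u v = (\<Sum>k\<in>{1..s}. \<Sum>w\<in>interior_points f.
    Poly_Mapping.lookup (power_part p \<sigma> f k) (int (p ^ k) *s w - u) * (\<sigma> ^^ k) (hasse_witt p f (s - k) w v))"
proof -
  have ne: "newton_polytope f \<noteq> {}"
    using u interior_subset by (auto simp: interior_points_def)
  have "hasse_witt p f s u v = (\<Sum>k\<in>{1..s}. Poly_Mapping.lookup
      (power_part p \<sigma> f k * laurent_frob (p ^ k) (\<sigma> ^^ k) (f ^ (p ^ (s - k) - 1))) (int (p ^ s) *s v - u))"
    unfolding hasse_witt_def by (subst power_decomposition[OF \<sigma> s]) (simp add: lookup_sum)
  also have "\<dots> = (\<Sum>k\<in>{1..s}. \<Sum>w\<in>interior_points f.
    Poly_Mapping.lookup (power_part p \<sigma> f k) (int (p ^ k) *s w - u) * (\<sigma> ^^ k) (hasse_witt p f (s - k) w v))"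
  proof (rule sum.cong[OF refl])
    fix k assume "k \<in> {1..s}"
    then have "int (p ^ s) *s v = int (p ^ k) *s (int (p ^ (s - k)) *s v)"
      by (simp add: vector_smult_assoc flip: power_add)
    then show "Poly_Mapping.lookup (power_part p \<sigma> f k * laurent_frob (p ^ k) (\<sigma> ^^ k) (f ^ (p ^ (s - k) - 1))) (int (p ^ s) *s v - u)
      = (\<Sum>w\<in>interior_points f. Poly_Mapping.lookup (power_part p \<sigma> f k) (int (p ^ k) *s w - u) * (\<sigma> ^^ k) (hasse_witt p f (s - k) w v))"
      unfolding hasse_witt_def using p
      by (simp only:) (intro lookup_mult_laurent_frob ring_endo_funpow frobenius_endo_ring_endo[OF \<sigma>]
          supported_in_power_part ne u zero_less_power)
  qed
  finally show ?thesis .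
qed


subsection \<open>Matrices over the residue rings and the completion\<close>

lemma to_residue_eq_iff:
  "to_residue p s a = to_residue p s b \<longleftrightarrow> of_nat (p ^ s) dvd a - (b :: 'r::comm_ring_1)"
proof
  assume "to_residue p s a = to_residue p s b"
  moreover have "a \<in> to_residue p s a" by (simp add: mem_to_residue)
  ultimately show "of_nat (p ^ s) dvd a - b" using mem_to_residue by blast
next
  assume ab: "of_nat (p ^ s) dvd a - b"
  then have ba: "of_nat (p ^ s) dvd b - a" by (metis dvd_minus_iff minus_diff_eq)
  have "of_nat (p ^ s) dvd y - a \<longleftrightarrow> of_nat (p ^ s) dvd y - b" for y
    using dvd_add[OF _ ab, of "y - a"] dvd_add[OF _ ba, of "y - b"] by auto
  then show "to_residue p s a = to_residue p s b"
    by (simp add: set_eq_iff mem_to_residue del: of_nat_power)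
qed

lemma finsum_residue_quot:
  fixes r :: "'i \<Rightarrow> 'r::comm_ring_1"
  assumes "finite K"
  shows "finsum (residue_quot p s) (\<lambda>k. to_residue p s (r k)) K = to_residue p s (sum r K)"
proof -
  interpret cring "residue_quot p s :: 'r set ring" by (rule cring_residue_quot)
  show ?thesis
    using assms by (induction K rule: finite_induct)
      (simp_all add: residue_ops, simp add: residue_ops carrier_residue_quot Pi_def)
qed

text \<open>Coherent representatives in R of an element of the inverse limit; they are not unique,
  and equality is read off level by level with \<open>represents_eq\<close>.\<close>

definition represents :: "nat \<Rightarrow> (nat \<Rightarrow> 'r::comm_ring_1 set) \<Rightarrow> (nat \<Rightarrow> 'r) \<Rightarrow> bool" where
  "represents p x r \<longleftrightarrow>
     x = (\<lambda>t. to_residue p t (r t)) \<and> (\<forall>t. of_nat (p ^ t) dvd r (Suc t) - r t)"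

lemma carrier_completion_iff: "x \<in> carrier (padic_completion p) \<longleftrightarrow> (\<exists>r. represents p x r)"
  by (auto simp: carrier_padic_completion represents_def)

lemma represents_carrier: "represents p x r \<Longrightarrow> x \<in> carrier (padic_completion p)"
  by (auto simp: carrier_completion_iff)

lemma represents_eq:
  "represents p x r \<Longrightarrow> represents p y r' \<Longrightarrow> x = y \<longleftrightarrow> (\<forall>t. of_nat (p ^ t) dvd r t - r' t)"
  by (simp add: represents_def fun_eq_iff to_residue_eq_iff del: of_nat_power)

lemma represents_const: "represents p (to_completion p c) (\<lambda>_. c)"
  by (simp add: represents_def to_completion_def)

lemma represents_zero: "represents p \<zero>\<^bsub>padic_completion p\<^esub> (\<lambda>_. 0)"
  and represents_one: "represents p \<one>\<^bsub>padic_completion p\<^esub> (\<lambda>_. 1)"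
  by (simp_all add: represents_def padic_completion_def residue_ops)

lemma represents_add:
  assumes "represents p x r" "represents p y r'"
  shows "represents p (x \<oplus>\<^bsub>padic_completion p\<^esub> y) (\<lambda>t. r t + r' t)"
proof -
  have "of_nat (p ^ t) dvd r (Suc t) + r' (Suc t) - (r t + r' t)" for t
    using assms unfolding represents_def add_diff_add by (intro dvd_add) auto
  then show ?thesis
    using assms unfolding represents_def by (simp add: padic_completion_def residue_ops)
qed

lemma represents_mult:
  assumes "represents p x r" "represents p y r'"
  shows "represents p (x \<otimes>\<^bsub>padic_completion p\<^esub> y) (\<lambda>t. r t * r' t)"
proof -
  have "of_nat (p ^ t) dvd r (Suc t) * r' (Suc t) - r t * r' t" for t
    unfolding mult_diff_mult using assms unfolding represents_def
    by (intro dvd_add dvd_mult dvd_mult2) auto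
  then show ?thesis
    using assms unfolding represents_def by (simp add: padic_completion_def residue_ops)
qed

lemma represents_minus:
  fixes x :: "nat \<Rightarrow> 'r::comm_ring_1 set"
  assumes "represents p x r" "represents p y r'"
  shows "represents p (x \<ominus>\<^bsub>padic_completion p\<^esub> y) (\<lambda>t. r t - r' t)"
proof -
  interpret cring "padic_completion p :: (nat \<Rightarrow> 'r set) ring" by (rule cring_padic_completion)
  let ?z = "\<lambda>t. to_residue p t (- r' t)"
  have "of_nat (p ^ t) dvd - r' (Suc t) - - r' t" for t
    using assms(2) unfolding represents_def by (metis dvd_minus_iff minus_diff_minus)
  then have z: "represents p ?z (\<lambda>t. - r' t)" by (simp add: represents_def)
  have "?z \<oplus>\<^bsub>padic_completion p\<^esub> y = \<zero>\<^bsub>padic_completion p\<^esub>"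
    using represents_eq[OF represents_add[OF z assms(2)] represents_zero] by simp
  then have "\<ominus>\<^bsub>padic_completion p\<^esub> y = ?z"
    using represents_carrier[OF z] represents_carrier[OF assms(2)] by (intro minus_equality)
  then show ?thesis
    using represents_add[OF assms(1) z] by (simp add: a_minus_def)
qed

lemma represents_sum:
  fixes x :: "'i \<Rightarrow> nat \<Rightarrow> 'r::comm_ring_1 set"
  assumes "finite K" "\<And>k. k \<in> K \<Longrightarrow> represents p (x k) (r k)"
  shows "represents p (finsum (padic_completion p) x K) (\<lambda>t. \<Sum>k\<in>K. r k t)"
proof -
  interpret cring "padic_completion p :: (nat \<Rightarrow> 'r set) ring" by (rule cring_padic_completion)
  show ?thesis
    using assms
  proof (induction K rule: finite_induct)
    case empty
    then show ?case by (simp add: represents_zero)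
  next
    case (insert k K)
    have "x \<in> K \<rightarrow> carrier (padic_completion p)" "x k \<in> carrier (padic_completion p)"
      using insert.prems represents_carrier by (auto simp: Pi_def)
    then show ?case
      using insert by (simp add: represents_add)
  qed
qed

lemma represents_of_nat:
  "represents p ([n] \<cdot>\<^bsub>padic_completion p\<^esub> \<one>\<^bsub>padic_completion p\<^esub>) (\<lambda>_. of_nat n :: 'r::comm_ring_1)"
proof -
  interpret cring "padic_completion p :: (nat \<Rightarrow> 'r set) ring" by (rule cring_padic_completion)
  show ?thesis
  proof (induction n)
    case 0
    then show ?case by (simp add: represents_zero)
  next
    case (Suc n)
    from represents_add[OF this represents_one] show ?case by (simp add: add.commute)
  qed
qed

text \<open>Torsion-freeness makes divisibility by \<open>p\<^sup>s\<close> in the completion visible at level \<open>s\<close>: if \<open>p\<^sup>s\<close>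
  divides \<open>r\<^sub>s\<close>, it divides all \<open>r\<^sub>t\<close> with \<open>t \<ge> s\<close>, and the quotients \<open>r\<^sub>t\<^sub>+\<^sub>s / p\<^sup>s\<close> are again coherent.\<close>

lemma mem_PIdl_completion:
  fixes r :: "nat \<Rightarrow> 'r::comm_ring_1"
  assumes tf: "char_zero TYPE('r)" and p: "p > 0" and x: "represents p x r" and s: "of_nat (p ^ s) dvd r s"
  shows "x \<in> PIdl\<^bsub>padic_completion p\<^esub> ([(p ^ s)] \<cdot>\<^bsub>padic_completion p\<^esub> \<one>\<^bsub>padic_completion p\<^esub>)"
proof -
  have coh: "of_nat (p ^ t) dvd r (t + k) - r t" for t k
  proof (induction k)
    case (Suc k)
    have "of_nat (p ^ (t + k)) dvd r (Suc (t + k)) - r (t + k)"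
      using x unfolding represents_def by blast
    then have "of_nat (p ^ t) dvd r (Suc (t + k)) - r (t + k)"
      by (rule dvd_trans[OF of_nat_dvd_mono[OF le_imp_power_dvd[OF le_add1]]])
    from dvd_add[OF this Suc] show ?case by simp
  qed simp
  have "of_nat (p ^ s) dvd r (s + t)" for t
    using dvd_add[OF coh[of s t] s] by simp
  then obtain y where y: "r (s + t) = of_nat (p ^ s) * y t" for t
    unfolding dvd_def by metis
  have "of_nat (p ^ t) dvd y (Suc t) - y t" for t
  proof -
    obtain c where "r (Suc (s + t)) - r (s + t) = of_nat (p ^ (s + t)) * c"
      using x unfolding represents_def by (meson dvdE)
    then have "of_nat (p ^ s) * (y (Suc t) - y t - of_nat (p ^ t) * c) = 0"
      using y[of t] y[of "Suc t"] by (simp add: algebra_simps power_add)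
    moreover have "p ^ s > 0" using p by simp
    ultimately have "y (Suc t) - y t - of_nat (p ^ t) * c = 0"
      using tf unfolding char_zero_iff_torsion_free by blast
    then show ?thesis by simp
  qed
  then have z: "represents p (\<lambda>t. to_residue p t (y t)) y" by (simp add: represents_def)
  have "of_nat (p ^ t) dvd r t - y t * of_nat (p ^ s)" for t
  proof -
    have "of_nat (p ^ t) dvd r t - r (t + s)"
      using coh[of t s] by (metis dvd_minus_iff minus_diff_eq)
    then show ?thesis using y[of t] by (simp add: add.commute[of s] mult.commute[of "y t"])
  qed
  then have "x = (\<lambda>t. to_residue p t (y t)) \<otimes>\<^bsub>padic_completion p\<^esub>
      ([(p ^ s)] \<cdot>\<^bsub>padic_completion p\<^esub> \<one>\<^bsub>padic_completion p\<^esub>)"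
    using represents_eq[OF x represents_mult[OF z represents_of_nat]] by blast
  then show ?thesis
    using represents_carrier[OF z] by (auto simp: cgenideal_def)
qed

section \<open>Matrix inverses over the completion\<close>

context finite_index
begin

definition represents_mat :: "nat \<Rightarrow> ('i, nat \<Rightarrow> 'r::comm_ring_1 set) matr \<Rightarrow> (nat \<Rightarrow> ('i, 'r) matr) \<Rightarrow> bool"
  where "represents_mat p M A \<longleftrightarrow> (\<forall>u\<in>J. \<forall>v\<in>J. represents p (M u v) (\<lambda>t. A t u v))"

lemma represents_mat_const: "represents_mat p (mat_map (to_completion p) A) (\<lambda>_. A)"
  by (simp add: represents_mat_def mat_map_def represents_const)

lemma represents_mat_one: "represents_mat p (mat_one (padic_completion p)) (\<lambda>_. mone)"
  by (auto simp: represents_mat_def mat_one_def[of "padic_completion p"] mat_one_base_ring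
      represents_zero represents_one)

lemma represents_mat_times:
  assumes "represents_mat p M A" "represents_mat p M' B"
  shows "represents_mat p (mat_mult (padic_completion p) J M M') (\<lambda>t. A t \<star> B t)"
  using assms unfolding represents_mat_def mat_times_apply mat_mult_def[of "padic_completion p"]
  by (auto intro!: represents_sum represents_mult finite_J)

text \<open>By \<open>mem_PIdl_completion\<close>, a congruence modulo p^s over the completion is
  decided by the representatives at level s alone.\<close>

lemma represents_mat_cong:
  fixes A :: "nat \<Rightarrow> ('i, 'r::comm_ring_1) matr"
  assumes "char_zero TYPE('r)" "p > 0" "represents_mat p M A" "represents_mat p M' B"
    and "mcong (p ^ s) (A s) (B s)"
  shows "mat_cong (padic_completion p) J (p ^ s) M M'"
  unfolding mat_cong_def
proof (intro ballI)
  fix u v assume uv: "u \<in> J" "v \<in> J"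
  then have "represents p (M u v \<ominus>\<^bsub>padic_completion p\<^esub> M' u v) (\<lambda>t. A t u v - B t u v)"
    using assms(3,4) unfolding represents_mat_def by (intro represents_minus) auto
  moreover have "of_nat (p ^ s) dvd A s u v - B s u v"
    using assms(5) uv unfolding mat_cong_base_ring by blast
  ultimately show "M u v \<ominus>\<^bsub>padic_completion p\<^esub> M' u v
      \<in> PIdl\<^bsub>padic_completion p\<^esub> ([(p ^ s)] \<cdot>\<^bsub>padic_completion p\<^esub> \<one>\<^bsub>padic_completion p\<^esub>)"
    by (rule mem_PIdl_completion[OF assms(1,2)])
qed

lemma represents_mat_eq:
  assumes "represents_mat p M A" "represents_mat p M' B"
  shows "(\<forall>u\<in>J. \<forall>v\<in>J. M u v = M' u v) \<longleftrightarrow> (\<forall>t. mcong (p ^ t) (A t) (B t))"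
proof -
  have "M u v = M' u v \<longleftrightarrow> (\<forall>t. of_nat (p ^ t) dvd A t u v - B t u v)" if "u \<in> J" "v \<in> J" for u v
    by (rule represents_eq) (use assms that in \<open>auto simp: represents_mat_def\<close>)
  then show ?thesis unfolding mat_cong_base_ring by blast
qed

lemma is_mat_inverse_completion_iff:
  fixes A :: "('i, 'r::comm_ring_1) matr"
  assumes "represents_mat p M B"
  shows "is_mat_inverse (padic_completion p) J (mat_map (to_completion p) A) M
    \<longleftrightarrow> (\<forall>t. inverse_mod (p ^ t) A (B t))"
proof -
  let ?A = "mat_map (to_completion p) A"
  note A = represents_mat_const[of p A]
  have "M u v \<in> carrier (padic_completion p)" if "u \<in> J" "v \<in> J" for u v
    using assms that represents_carrier unfolding represents_mat_def by blast
  then show ?thesis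
    unfolding is_mat_inverse_def inverse_mod_def
    using represents_mat_eq[OF represents_mat_times[OF A assms] represents_mat_one]
      represents_mat_eq[OF represents_mat_times[OF assms A] represents_mat_one] by blast
qed

text \<open>Inverses modulo p^t are unique modulo p^t, so arbitrarily chosen ones are automatically
  coherent and define a matrix over the completion.\<close>

lemma mat_invertible_completion:
  fixes A :: "('i, 'r::comm_ring_1) matr"
  assumes "\<And>t. \<exists>B. inverse_mod (p ^ t) A B"
  shows "mat_invertible (padic_completion p) J (mat_map (to_completion p) A)"
proof -
  obtain B where B: "inverse_mod (p ^ t) A (B t)" for t using assms by metis
  have "mcong (p ^ t) (B (Suc t)) (B t)" for t
    by (rule inverse_mod_unique[OF inverse_mod_mono[OF B] B]) simp_all
  then have "represents_mat p (\<lambda>u v t. to_residue p t (B t u v)) B"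
    unfolding represents_mat_def represents_def mat_cong_base_ring by simp
  from is_mat_inverse_completion_iff[OF this, of A] B show ?thesis
    unfolding mat_invertible_def by blast
qed

lemma mat_inverse_completion:
  fixes A :: "('i, 'r::comm_ring_1) matr"
  assumes "mat_invertible (padic_completion p) J (mat_map (to_completion p) A)"
  obtains B where "represents_mat p (mat_inverse (padic_completion p) J (mat_map (to_completion p) A)) B"
    "\<And>t. inverse_mod (p ^ t) A (B t)"
proof -
  let ?M = "mat_inverse (padic_completion p) J (mat_map (to_completion p) A)"
  have inv: "is_mat_inverse (padic_completion p) J (mat_map (to_completion p) A) ?M"
    using assms unfolding mat_invertible_def mat_inverse_def by (rule someI_ex)
  then have "\<exists>r. represents p (?M u v) r" if "u \<in> J" "v \<in> J" for u v
    using that unfolding is_mat_inverse_def carrier_completion_iff by blast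
  then obtain r where "represents p (?M u v) (r u v)" if "u \<in> J" "v \<in> J" for u v by metis
  then have "represents_mat p ?M (\<lambda>t u v. r u v t)"
    by (simp add: represents_mat_def)
  with is_mat_inverse_completion_iff[OF this] inv that show ?thesis by blast
qed

lemma inverse_mod_of_residue:
  fixes A :: "('i, 'r::comm_ring_1) matr"
  assumes "mat_invertible (residue_quot p 1) J (mat_map (to_residue p 1) A)"
  shows "\<exists>B. inverse_mod p A B"
proof -
  let ?A = "mat_map (to_residue p 1) A"
  obtain M where M: "is_mat_inverse (residue_quot p 1) J ?A M"
    using assms unfolding mat_invertible_def by blast
  then have "\<forall>u v. \<exists>b. u \<in> J \<longrightarrow> v \<in> J \<longrightarrow> M u v = to_residue p 1 b"
    unfolding is_mat_inverse_def carrier_residue_quot by blast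
  then obtain B where B: "M u v = to_residue p 1 (B u v)" if "u \<in> J" "v \<in> J" for u v by metis
  have one: "mat_one (residue_quot p 1) u v = to_residue p 1 (mone u v :: 'r)" for u v :: 'i
    unfolding mat_one_base_ring mat_one_def[of "residue_quot p 1"] residue_ops(3,4)
    by (rule if_distrib[symmetric])
  interpret cring "residue_quot p 1 :: 'r set ring" by (rule cring_residue_quot)
  have times: "mat_mult (residue_quot p 1) J M' Z u v = to_residue p 1 ((C \<star> D) u v)"
    if "\<And>u v. u \<in> J \<Longrightarrow> v \<in> J \<Longrightarrow> M' u v = to_residue p 1 (C u v)"
      "\<And>u v. u \<in> J \<Longrightarrow> v \<in> J \<Longrightarrow> Z u v = to_residue p 1 (D u v)" "u \<in> J" "v \<in> J"
    for M' Z and C D :: "('i, 'r) matr" and u v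
  proof -
    have "mat_mult (residue_quot p 1) J M' Z u v
      = finsum (residue_quot p 1) (\<lambda>w. to_residue p 1 (C u w * D w v)) J"
      unfolding mat_mult_def
      by (rule finsum_cong') (use that in \<open>auto simp: residue_ops carrier_residue_quot\<close>)
    then show ?thesis by (simp add: finsum_residue_quot finite_J mat_times_apply)
  qed
  have A: "?A u v = to_residue p 1 (A u v)" for u v by (simp add: mat_map_def)
  have "of_nat (p ^ 1) dvd (A \<star> B) u v - mone u v" "of_nat (p ^ 1) dvd (B \<star> A) u v - mone u v"
    if uv: "u \<in> J" "v \<in> J" for u v
  proof -
    have "mat_mult (residue_quot p 1) J ?A M u v = mat_one (residue_quot p 1) u v"
      "mat_mult (residue_quot p 1) J M ?A u v = mat_one (residue_quot p 1) u v"
      using M uv unfolding is_mat_inverse_def by blast+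
    moreover have "mat_mult (residue_quot p 1) J ?A M u v = to_residue p 1 ((A \<star> B) u v)"
      "mat_mult (residue_quot p 1) J M ?A u v = to_residue p 1 ((B \<star> A) u v)"
      using A B uv by (intro times; simp only:)+
    ultimately show "of_nat (p ^ 1) dvd (A \<star> B) u v - mone u v" "of_nat (p ^ 1) dvd (B \<star> A) u v - mone u v"
      by (simp_all only: one to_residue_eq_iff[symmetric])
  qed
  then show ?thesis
    by (intro exI[of _ B]) (simp add: inverse_mod_def mat_cong_base_ring)
qed

end

section \<open>Transfer of the congruences to the completion\<close>

context frobenius_recursion
begin

context
  fixes B\<^sub>1 :: "('i, 'r) matr"
  assumes inverse_a_1: "inverse_mod p (a 1) B\<^sub>1"
    and char_zero: "char_zero TYPE('r)"
begin

lemma ex_inverse_mod_power: "\<exists>B. inverse_mod (p ^ t) (a s) B"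
  using inverse_mod_p[OF inverse_a_1, of s] inverse_mod_power by blast

lemma mat_invertible_frob: "mat_invertible (padic_completion p) J (mat_map (to_completion p) (frob m (a s)))"
  using ex_inverse_mod_power[of _ s] inverse_mod_map[OF endo[of m], of _ "a s"]
  by (intro mat_invertible_completion) metis

text \<open>At level n the inverse over the completion is represented by some inverse modulo p^n,
  which by uniqueness agrees with the given \<open>frob i (b r)\<close>. Hence a congruence with the
  latter suffices.\<close>

lemma mat_cong_completion_times_inverse:
  assumes inv: "\<And>r. inverse_mod (p ^ N) (a r) (b r)" and n: "n \<le> N"
    and cong: "mcong (p ^ n) (A \<star> frob i (b r)) (A' \<star> frob i' (b r'))"
  shows "mat_cong (padic_completion p) J (p ^ n)
    (mat_mult (padic_completion p) J (mat_map (to_completion p) A)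
       (mat_inverse (padic_completion p) J (mat_map (to_completion p) (frob i (a r)))))
    (mat_mult (padic_completion p) J (mat_map (to_completion p) A')
       (mat_inverse (padic_completion p) J (mat_map (to_completion p) (frob i' (a r')))))"
proof -
  obtain B where B: "represents_mat p (mat_inverse (padic_completion p) J (mat_map (to_completion p) (frob i (a r)))) B"
    "\<And>t. inverse_mod (p ^ t) (frob i (a r)) (B t)"
    using mat_inverse_completion[OF mat_invertible_frob] by blast
  obtain B' where B': "represents_mat p (mat_inverse (padic_completion p) J (mat_map (to_completion p) (frob i' (a r')))) B'"
    "\<And>t. inverse_mod (p ^ t) (frob i' (a r')) (B' t)"
    using mat_inverse_completion[OF mat_invertible_frob] by blast
  have b: "inverse_mod (p ^ n) (frob j (a q)) (frob j (b q))" for j q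
    by (intro inverse_mod_map endo inverse_mod_mono[OF inv] le_imp_power_dvd n)
  have "mcong (p ^ n) (A \<star> B n) (A \<star> frob i (b r))"
    by (rule mcong_times[OF mcong_refl inverse_mod_unique[OF B(2) b mcong_refl]])
  also note cong
  also have "mcong (p ^ n) (A' \<star> frob i' (b r')) (A' \<star> B' n)"
    by (rule mcong_times[OF mcong_refl inverse_mod_unique[OF b B'(2) mcong_refl]])
  finally show ?thesis
    by (rule represents_mat_cong[OF char_zero p_pos
          represents_mat_times[OF represents_mat_const B(1)] represents_mat_times[OF represents_mat_const B'(1)]])
qed

lemma mat_cong_a_step:
  assumes "s \<ge> 1"
  shows "mat_cong (padic_completion p) J (p ^ s)
    (mat_mult (padic_completion p) J (mat_map (to_completion p) (a (s + 1)))
       (mat_inverse (padic_completion p) J (mat_map (to_completion p) (mat_map \<sigma> (a s)))))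
    (mat_mult (padic_completion p) J (mat_map (to_completion p) (a s))
       (mat_inverse (padic_completion p) J (mat_map (to_completion p) (mat_map \<sigma> (a (s - 1))))))"
proof -
  obtain b where b: "inverse_mod (p ^ s) (a r) (b r)" for r
    using ex_inverse_mod_power by metis
  then interpret invertible_frobenius_recursion J p \<sigma> a \<beta> s b
    by unfold_locales
  show ?thesis
    using mat_cong_completion_times_inverse[OF b order_refl a_step_cong[OF assms order_refl]] by simp
qed

lemma mat_cong_log_derivative:
  assumes D: "is_derivation D"
  shows "mat_cong (padic_completion p) J (p ^ (s + m))
    (mat_mult (padic_completion p) J (mat_map (to_completion p) (mat_map D (frob m (a (s + 1)))))
       (mat_inverse (padic_completion p) J (mat_map (to_completion p) (frob m (a (s + 1))))))
    (mat_mult (padic_completion p) J (mat_map (to_completion p) (mat_map D (frob m (a s))))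
       (mat_inverse (padic_completion p) J (mat_map (to_completion p) (frob m (a s)))))"
proof -
  \<comment> \<open>One power beyond s+m, because \<open>log_derivative_cong\<close> asks for s + m
    < N.\<close>
  obtain b where b: "inverse_mod (p ^ Suc (s + m)) (a r) (b r)" for r
    using ex_inverse_mod_power by metis
  then interpret invertible_frobenius_recursion J p \<sigma> a \<beta> "Suc (s + m)" b
    by unfold_locales
  show ?thesis
    using mat_cong_completion_times_inverse[OF b _ log_derivative_cong[OF D lessI]] by simp
qed

end

end

section \<open>Conclusion for the higher Hasse-Witt matrices\<close>

lemma hasse_witt_frobenius_recursion:
  fixes f :: "('r::comm_ring_1, 'n::finite) laurent"
  assumes p: "Factorial_Ring.prime p" and \<sigma>: "frobenius_endo p \<sigma>"
  shows "frobenius_recursion (interior_points f) p \<sigma> (hasse_witt p f)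
    (\<lambda>k u v. Poly_Mapping.lookup (power_part p \<sigma> f k) (int (p ^ k) *s v - u))"
proof -
  interpret finite_index "interior_points f"
    by unfold_locales (rule finite_interior_points)
  have p_pos: "p > 0" using p prime_gt_0_nat by simp
  show ?thesis
  proof (unfold_locales, goal_cases)
    case (4 s u v)
    then show ?case
      unfolding mat_times_apply mat_map_def by (intro hasse_witt_decomposition \<sigma> p_pos)
  next
    case (5 k u v)
    then show ?case by (intro of_nat_dvd_lookup power_part_dvd p \<sigma>)
  qed (rule p_pos \<sigma> hasse_witt_0)+
qed

text \<open>\<open>mat_inverse\<close> is defined by choice; the conjunct on
  \<open>mat_invertible\<close> certifies that every inverse in the two congruences after it is
  genuine, those of \<sigma>(\<alpha>_s) being the case m = 1.\<close>

theorem theorem1: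
  fixes f :: "('r::comm_ring_1, 'n::finite) laurent"
    and p :: nat
    and J :: "(int ^ 'n) set"
    and \<alpha> :: "nat \<Rightarrow> (int ^ 'n, 'r) matr"
  assumes "char_zero TYPE('r)"
    and "Factorial_Ring.prime p"
    and "J = interior_points f"
    and "J \<noteq> {}"
    and "\<alpha> = hasse_witt p f"
  shows
    "(\<forall>\<sigma>. frobenius_endo p \<sigma> \<longrightarrow>
        (\<forall>s\<ge>1. mat_cong base_ring J p
           (\<alpha> s)
           (mat_prod base_ring J (\<lambda>i. mat_map (\<sigma> ^^ i) (\<alpha> 1)) s)))
   \<and> (mat_invertible (residue_quot p 1) J (mat_map (to_residue p 1) (\<alpha> 1)) \<longrightarrow>
      (\<forall>\<sigma>. frobenius_endo p \<sigma> \<longrightarrow>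
        (let C = padic_completion p;
             \<iota> = mat_map (to_completion p)
         in
           (\<forall>m s. mat_invertible C J (\<iota> (mat_map (\<sigma> ^^ m) (\<alpha> s))))
         \<and> (\<forall>s\<ge>1. mat_cong C J (p ^ s)
              (mat_mult C J (\<iota> (\<alpha> (s + 1))) (mat_inverse C J (\<iota> (mat_map \<sigma> (\<alpha> s)))))
              (mat_mult C J (\<iota> (\<alpha> s)) (mat_inverse C J (\<iota> (mat_map \<sigma> (\<alpha> (s - 1)))))))
         \<and> (\<forall>D. is_derivation D \<longrightarrow> (\<forall>s m. mat_cong C J (p ^ (s + m))
              (mat_mult C J (\<iota> (mat_map D (mat_map (\<sigma> ^^ m) (\<alpha> (s + 1)))))
                 (mat_inverse C J (\<iota> (mat_map (\<sigma> ^^ m) (\<alpha> (s + 1))))))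
              (mat_mult C J (\<iota> (mat_map D (mat_map (\<sigma> ^^ m) (\<alpha> s))))
                 (mat_inverse C J (\<iota> (mat_map (\<sigma> ^^ m) (\<alpha> s))))))))))"
proof -
  \<comment> \<open>The matrices \<beta>_k depend on \<sigma>, while \<alpha> does not, so the
    recursion is instantiated separately for each Frobenius endomorphism.\<close>
  have rec: "\<exists>\<beta>. frobenius_recursion J p \<sigma> \<alpha> \<beta>" if "frobenius_endo p \<sigma>" for \<sigma>
    using hasse_witt_frobenius_recursion[OF assms(2) that, of f] assms(3,5) by blast
  have part1: "mat_cong base_ring J p (\<alpha> s) (mat_prod base_ring J (\<lambda>i. mat_map (\<sigma> ^^ i) (\<alpha> 1)) s)"
    if "frobenius_endo p \<sigma>" for \<sigma> s
    using rec[OF that] frobenius_recursion.a_mod_p by blast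
  interpret finite_index J
    by unfold_locales (simp add: assms(3) finite_interior_points)
  show ?thesis
    unfolding Let_def
  proof (intro conjI impI allI)
    fix \<sigma> :: "'r \<Rightarrow> 'r" and s m
    assume inv: "mat_invertible (residue_quot p 1) J (mat_map (to_residue p 1) (\<alpha> 1))"
      and \<sigma>: "frobenius_endo p \<sigma>"
    obtain B where B: "inverse_mod p (\<alpha> 1) B"
      using inverse_mod_of_residue[OF inv] by blast
    obtain \<beta> where "frobenius_recursion J p \<sigma> \<alpha> \<beta>" using rec[OF \<sigma>] by blast
    then interpret frobenius_recursion J p \<sigma> \<alpha> \<beta> .
    show "mat_invertible (padic_completion p) J (mat_map (to_completion p) (mat_map (\<sigma> ^^ m) (\<alpha> s)))"
      by (rule mat_invertible_frob[OF B assms(1)])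
  next
    fix \<sigma> :: "'r \<Rightarrow> 'r" and s :: nat
    assume inv: "mat_invertible (residue_quot p 1) J (mat_map (to_residue p 1) (\<alpha> 1))"
      and \<sigma>: "frobenius_endo p \<sigma>" and s: "1 \<le> s"
    obtain B where B: "inverse_mod p (\<alpha> 1) B"
      using inverse_mod_of_residue[OF inv] by blast
    obtain \<beta> where "frobenius_recursion J p \<sigma> \<alpha> \<beta>" using rec[OF \<sigma>] by blast
    then interpret frobenius_recursion J p \<sigma> \<alpha> \<beta> .
    show "mat_cong (padic_completion p) J (p ^ s)
        (mat_mult (padic_completion p) J (mat_map (to_completion p) (\<alpha> (s + 1)))
           (mat_inverse (padic_completion p) J (mat_map (to_completion p) (mat_map \<sigma> (\<alpha> s)))))
        (mat_mult (padic_completion p) J (mat_map (to_completion p) (\<alpha> s))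
           (mat_inverse (padic_completion p) J (mat_map (to_completion p) (mat_map \<sigma> (\<alpha> (s - 1))))))"
      by (rule mat_cong_a_step[OF B assms(1) s])
  next
    fix \<sigma> D :: "'r \<Rightarrow> 'r" and s m
    assume inv: "mat_invertible (residue_quot p 1) J (mat_map (to_residue p 1) (\<alpha> 1))"
      and \<sigma>: "frobenius_endo p \<sigma>" and D: "is_derivation D"
    obtain B where B: "inverse_mod p (\<alpha> 1) B"
      using inverse_mod_of_residue[OF inv] by blast
    obtain \<beta> where "frobenius_recursion J p \<sigma> \<alpha> \<beta>" using rec[OF \<sigma>] by blast
    then interpret frobenius_recursion J p \<sigma> \<alpha> \<beta> .
    show "mat_cong (padic_completion p) J (p ^ (s + m))
        (mat_mult (padic_completion p) J (mat_map (to_completion p) (mat_map D (mat_map (\<sigma> ^^ m) (\<alpha> (s + 1)))))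
           (mat_inverse (padic_completion p) J (mat_map (to_completion p) (mat_map (\<sigma> ^^ m) (\<alpha> (s + 1))))))
        (mat_mult (padic_completion p) J (mat_map (to_completion p) (mat_map D (mat_map (\<sigma> ^^ m) (\<alpha> s))))
           (mat_inverse (padic_completion p) J (mat_map (to_completion p) (mat_map (\<sigma> ^^ m) (\<alpha> s)))))"
      by (rule mat_cong_log_derivative[OF B assms(1) D])
  qed (rule part1)
qed

end
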